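(* Let $\mathcal D$ be a distribution over $\mathbb R^d$ with mean $\mu\in[-R,R]^d$ and $k$-th moment bounded by $1$, i.e. $\mathbb E_{X\sim\mathcal D}[|\langle X-\mu,v\rangle|^k]\le1$ for all unit vectors $v$. Let $\epsilon,\alpha,\beta>0$ with $\alpha\le c\, m^{-(k-1)/k}$ for a sufficiently small constant $c>0$. Suppose we are given \[ n\ge O_k\left(\frac{d\log d}{m\alpha^2\beta}+\frac{d\log(d/\beta)\sqrt{\log m}}{\sqrt m\alpha\epsilon}+\frac{d\log(d/\beta)}{m\alpha^{k/(k-1)}\epsilon}+\frac{d\log(dRm/\beta)}{\epsilon}\right) \] independently drawn batches $X^{(i)}=(X^{(i)}_1,\dots,X^{(i)}_m)\sim\mathcal D^{\otimes m}$, $i\in[n]$. Then there exists a (person-level) $\epsilon$-DP mechanism which, given $(X^{(1)},\dots,X^{(n)})$, outputs $\hat\mu$ with $\|\hat\mu-\mu\|_2\le\alpha$ with probability at least $1-\beta$.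
   Context: Each batch $X^{(i)}$ is the data of one person; an algorithm is person-level $\epsilon$-DP if for any two datasets differing in one entire batch $X,X'$ and any output set $Y$, $\Pr[A(X)\in Y]\le e^{\epsilon}\Pr[A(X')\in Y]$. $O_k$ hides factors depending only on $k$. The bound $R$ is known to the mechanism.
   Formalization: The formal statement takes k to be a real number at least 2, and for d = 1 reads log d and log(d/β) with 2 in place of d; without these the bound is undefined (k = 1) or the claim fails for large ε. *)

theory Defs
  imports "HOL-Probability.Probability"
begin

text \<open>
  The constants in the sample bound may not depend on \<open>d\<close>, \<open>m\<close> or \<open>n\<close>, so the dimension is a
  number rather than an index type: points of \<open>\<real>\<^sup>d\<close> are functions on \<open>{..<d}\<close> (extended by
  \<^const>\<open>undefined\<close>, as elements of \<^const>\<open>PiM\<close> are), with the Euclidean norm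
  \<open>L2_set x {..<d}\<close>.
\<close>

definition euclid :: "nat \<Rightarrow> (nat \<Rightarrow> real) measure" where
  "euclid d = (\<Pi>\<^sub>M i\<in>{..<d}. borel)"

definition inner_d :: "nat \<Rightarrow> (nat \<Rightarrow> real) \<Rightarrow> (nat \<Rightarrow> real) \<Rightarrow> real" where
  "inner_d d x y = (\<Sum>i<d. x i * y i)"

definition distribution_on :: "nat \<Rightarrow> (nat \<Rightarrow> real) measure \<Rightarrow> bool" where
  "distribution_on d D \<longleftrightarrow> prob_space D \<and> sets D = sets (euclid d)"

definition has_mean :: "nat \<Rightarrow> (nat \<Rightarrow> real) measure \<Rightarrow> (nat \<Rightarrow> real) \<Rightarrow> bool" where
  "has_mean d D \<mu> \<longleftrightarrow> (\<forall>i<d. integrable D (\<lambda>x. x i) \<and> (\<integral>x. x i \<partial>D) = \<mu> i)"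

text \<open>The nonnegative integral is \<open>\<infinity>\<close>, not \<open>0\<close>, when the moment does not exist.\<close>

definition moment_le_1 ::
    "nat \<Rightarrow> real \<Rightarrow> (nat \<Rightarrow> real) measure \<Rightarrow> (nat \<Rightarrow> real) \<Rightarrow> bool" where
  "moment_le_1 d k D \<mu> \<longleftrightarrow>
     (\<forall>v. L2_set v {..<d} = 1 \<longrightarrow>
        (\<integral>\<^sup>+x. ennreal (\<bar>inner_d d (\<lambda>i. x i - \<mu> i) v\<bar> powr k) \<partial>D) \<le> 1)"

text \<open>
  A dataset \<open>X\<close> consists of \<open>n\<close> batches of \<open>m\<close> points: \<open>X i j\<close> is the \<open>j\<close>-th point of person \<open>i\<close>.
\<close>

definition datasets :: "nat \<Rightarrow> nat \<Rightarrow> nat \<Rightarrow> (nat \<Rightarrow> nat \<Rightarrow> nat \<Rightarrow> real) measure" where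
  "datasets n m d = (\<Pi>\<^sub>M i\<in>{..<n}. \<Pi>\<^sub>M j\<in>{..<m}. euclid d)"

definition iid_batches ::
    "nat \<Rightarrow> nat \<Rightarrow> (nat \<Rightarrow> real) measure \<Rightarrow> (nat \<Rightarrow> nat \<Rightarrow> nat \<Rightarrow> real) measure" where
  "iid_batches n m D = (\<Pi>\<^sub>M i\<in>{..<n}. \<Pi>\<^sub>M j\<in>{..<m}. D)"

text \<open>A mechanism is a Markov kernel from datasets to \<open>\<real>\<^sup>d\<close>.\<close>

definition mechanism ::
    "nat \<Rightarrow> nat \<Rightarrow> nat \<Rightarrow> ((nat \<Rightarrow> nat \<Rightarrow> nat \<Rightarrow> real) \<Rightarrow> (nat \<Rightarrow> real) measure) \<Rightarrow> bool" where
  "mechanism n m d A \<longleftrightarrow> A \<in> datasets n m d \<rightarrow>\<^sub>M prob_algebra (euclid d)"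

definition person_neighbours ::
    "nat \<Rightarrow> (nat \<Rightarrow> nat \<Rightarrow> nat \<Rightarrow> real) \<Rightarrow> (nat \<Rightarrow> nat \<Rightarrow> nat \<Rightarrow> real) \<Rightarrow> bool" where
  "person_neighbours n X X' \<longleftrightarrow> (\<exists>i<n. \<forall>j<n. j \<noteq> i \<longrightarrow> X j = X' j)"

definition person_level_dp ::
    "nat \<Rightarrow> nat \<Rightarrow> nat \<Rightarrow> real \<Rightarrow>
     ((nat \<Rightarrow> nat \<Rightarrow> nat \<Rightarrow> real) \<Rightarrow> (nat \<Rightarrow> real) measure) \<Rightarrow> bool" where
  "person_level_dp n m d \<epsilon> A \<longleftrightarrow>
     (\<forall>X\<in>space (datasets n m d). \<forall>X'\<in>space (datasets n m d). person_neighbours n X X' \<longrightarrow>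
        (\<forall>Y\<in>sets (euclid d). measure (A X) Y \<le> exp \<epsilon> * measure (A X') Y))"

text \<open>
  In dimension 1 the factors \<open>log d\<close> and \<open>log (d/\<beta>)\<close> are read with \<open>2\<close> in place of \<open>d\<close>. Read literally,
  \<open>log 1 = 0\<close> would remove the sampling error term altogether, and for large \<open>\<epsilon>\<close> a single sample
  would have to determine the mean to any accuracy.
\<close>

definition sample_bound ::
    "real \<Rightarrow> nat \<Rightarrow> nat \<Rightarrow> real \<Rightarrow> real \<Rightarrow> real \<Rightarrow> real \<Rightarrow> real" where
  "sample_bound k d m R \<epsilon> \<alpha> \<beta> =
     real d * ln (max 2 (real d)) / (real m * \<alpha>\<^sup>2 * \<beta>)
     + real d * ln (max 2 (real d) / \<beta>) * sqrt (ln (real m)) / (sqrt (real m) * \<alpha> * \<epsilon>)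
     + real d * ln (max 2 (real d) / \<beta>) / (real m * \<alpha> powr (k / (k - 1)) * \<epsilon>)
     + real d * ln (real d * R * real m / \<beta>) / \<epsilon>"

text \<open>Drawing the batches from \<open>D\<close> and then running \<open>A\<close> on them.\<close>

definition output_distr ::
    "nat \<Rightarrow> nat \<Rightarrow> (nat \<Rightarrow> real) measure \<Rightarrow>
     ((nat \<Rightarrow> nat \<Rightarrow> nat \<Rightarrow> real) \<Rightarrow> (nat \<Rightarrow> real) measure) \<Rightarrow> (nat \<Rightarrow> real) measure" where
  "output_distr n m D A = iid_batches n m D \<bind> A"

end

theory Submission
  imports Defs
begin

text \<open>
  The mechanism is the exponential mechanism on a finite grid of candidates \<open>y\<close> in \<open>[-R, R]\<^sup>d\<close>. Each person
  contributes the projections of the batch mean \<open>Y\<^sub>i\<close> on a finite net of unit vectors \<open>v\<close>, and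
  the score of \<open>y\<close> is the maximum over \<open>v\<close> of \<open>\<Sum>\<^sub>i clip \<tau> \<langle>Y\<^sub>i - y, v\<rangle>\<close>; one person changes it by at most \<open>2\<tau>\<close>.
  The clipping level is \<open>\<tau> \<approx> max (sqrt (ln m / m)) (m\<^sup>-\<^sup>1 \<alpha> powr (- 1 / (k - 1)))\<close>: by a Fuk-Nagaev type estimate,
  clipping a batch mean at this level costs bias \<open>O(\<alpha>)\<close>. By Bernstein's inequality and a union bound over the net,
  the clipped sums then concentrate, so a candidate at distance \<open>r > \<alpha>\<close> from the mean scores worse than a
  nearby grid point by \<open>\<Omega>(n min r \<tau>)\<close>. As this gap grows with \<open>r\<close>, the total weight of the bad candidates at
  distance at most \<open>\<tau>\<close> is bounded independently of \<open>R\<close>; only the farther ones cost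
  the term with \<open>ln R\<close>.
\<close>

text \<open>The sampling term \<open>d ln d / (m \<alpha>^2 \<beta>)\<close> of the bound contains
  neither \<open>R\<close> nor \<open>\<epsilon>\<close>, and this shapes the proof. A union bound
  over the grid would bring \<open>ln R\<close> into it, so concentration must be uniform in the
  candidates, with events indexed by directions alone; a net of size \<open>2 (9 d)^d\<close> costs
  only the admissible order \<open>d ln d\<close>. Clipping does harm only through its bias, hence
  tails of batch means enter as expected overshoots above a level and not as probabilities. The
  error budget is a fraction of \<alpha>: bias \<alpha>/80, deviation of the clipped average
  \<alpha>/20, rounding of the mean to the grid \<alpha>/20, against at least \<alpha>/2 gained in
  score by a bad candidate. A second obstacle is that \<open>ln (d R m / \<beta>)\<close> may be
  negative. If the origin is already accurate or \<beta> \<ge> 1, a constant output suffices;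
  otherwise \<open>R sqrt d > \<alpha>\<close>, and the negative part is at most half of the term
  with \<open>\<alpha> powr (k / (k - 1))\<close>.\<close>

section \<open>Finite mechanisms\<close>

text \<open>The identity \<open>distr\<close> only replaces the power set of \<open>G\<close> by the
  sigma-algebra of \<open>N\<close>, so that the result can be a point of
  \<open>prob_algebra N\<close>.\<close>

definition finite_mechanism ::
    "'b measure \<Rightarrow> 'b set \<Rightarrow> ('b \<Rightarrow> 'a \<Rightarrow> real) \<Rightarrow> 'a \<Rightarrow> 'b measure" where
  "finite_mechanism N G w X =
     distr (density (count_space G) (\<lambda>y. ennreal (w y X / (\<Sum>z\<in>G. w z X)))) N (\<lambda>y. y)"

context
  fixes N :: "'b measure" and G :: "'b set" and w :: "'b \<Rightarrow> 'a \<Rightarrow> real"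
  assumes finG: "finite G" and neG: "G \<noteq> {}" and subG: "G \<subseteq> space N"
    and pos: "\<And>y X. w y X > 0"
begin

lemma weight_sum_pos: "(\<Sum>z\<in>G. w z X) > 0"
  using finG neG pos by (intro sum_pos) auto

lemma emeasure_finite_mechanism:
  assumes Y: "Y \<in> sets N"
  shows "emeasure (finite_mechanism N G w X) Y = ennreal (\<Sum>y\<in>G \<inter> Y. w y X / (\<Sum>z\<in>G. w z X))"
proof -
  have nn: "0 \<le> w y X / (\<Sum>z\<in>G. w z X)" for y
    using pos[of y X] weight_sum_pos[of X] by simp
  have "emeasure (finite_mechanism N G w X) Y =
      (\<integral>\<^sup>+y. ennreal (w y X / (\<Sum>z\<in>G. w z X)) * indicator (G \<inter> Y) y \<partial>count_space G)"
    unfolding finite_mechanism_def using subG Y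
    by (subst emeasure_distr) (auto simp: emeasure_density Int_commute)
  also have "\<dots> = (\<Sum>y\<in>G. ennreal (w y X / (\<Sum>z\<in>G. w z X)) * indicator (G \<inter> Y) y)"
    by (rule nn_integral_count_space_finite[OF finG])
  also have "\<dots> = (\<Sum>y\<in>G \<inter> Y. ennreal (w y X / (\<Sum>z\<in>G. w z X)))"
    using finG by (intro sum.mono_neutral_cong_right) (auto simp: indicator_def)
  also have "\<dots> = ennreal (\<Sum>y\<in>G \<inter> Y. w y X / (\<Sum>z\<in>G. w z X))"
    using nn by (simp add: sum_ennreal)
  finally show ?thesis .
qed

lemma measure_finite_mechanism:
  assumes "Y \<in> sets N"
  shows "measure (finite_mechanism N G w X) Y = (\<Sum>y\<in>G \<inter> Y. w y X) / (\<Sum>z\<in>G. w z X)"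
  using emeasure_finite_mechanism[OF assms, of X] pos weight_sum_pos[of X]
  by (simp add: measure_def sum_divide_distrib less_imp_le sum_nonneg)

lemma sets_finite_mechanism [simp]: "sets (finite_mechanism N G w X) = sets N"
  by (simp add: finite_mechanism_def)

lemma prob_space_finite_mechanism: "prob_space (finite_mechanism N G w X)"
proof
  have "G \<inter> space N = G" using subG by auto
  then show "emeasure (finite_mechanism N G w X) (space (finite_mechanism N G w X)) = 1"
    using emeasure_finite_mechanism[of "space N" X] weight_sum_pos[of X]
    by (simp add: finite_mechanism_def sum_divide_distrib[symmetric])
qed

lemma measurable_finite_mechanism:
  assumes w: "\<And>y. y \<in> G \<Longrightarrow> w y \<in> borel_measurable M"
  shows "finite_mechanism N G w \<in> M \<rightarrow>\<^sub>M prob_algebra N"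
proof (rule measurable_prob_algebraI)
  show "prob_space (finite_mechanism N G w x)" for x
    by (rule prob_space_finite_mechanism)
  show "finite_mechanism N G w \<in> M \<rightarrow>\<^sub>M subprob_algebra N"
  proof (rule measurable_subprob_algebra)
    fix Y assume Y: "Y \<in> sets N"
    have [measurable]: "w y \<in> borel_measurable M" if "y \<in> G \<inter> Y" for y using w that by auto
    have [measurable]: "(\<lambda>X. \<Sum>z\<in>G. w z X) \<in> borel_measurable M"
      using w by (intro borel_measurable_sum)
    show "(\<lambda>a. emeasure (finite_mechanism N G w a) Y) \<in> borel_measurable M"
      by (subst emeasure_finite_mechanism[OF Y]) measurable
  qed (auto intro: prob_space_imp_subprob_space prob_space_finite_mechanism)
qed

text \<open>The change of the weights enters twice, in the numerator and in the normalising sum, so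
  each occurrence gets half of the privacy budget.\<close>

lemma measure_finite_mechanism_ratio:
  assumes Y: "Y \<in> sets N" and le: "\<And>y. y \<in> G \<Longrightarrow> w y X \<le> exp (\<epsilon> / 2) * w y X'"
    and ge: "\<And>y. y \<in> G \<Longrightarrow> w y X' \<le> exp (\<epsilon> / 2) * w y X"
  shows "measure (finite_mechanism N G w X) Y \<le> exp \<epsilon> * measure (finite_mechanism N G w X') Y"
proof -
  let ?S = "\<lambda>X. \<Sum>z\<in>G. w z X" and ?P = "\<lambda>X. \<Sum>z\<in>G \<inter> Y. w z X"
  have S: "?S X > 0" "?S X' > 0" by (rule weight_sum_pos)+
  have "?P X \<le> (\<Sum>z\<in>G \<inter> Y. exp (\<epsilon> / 2) * w z X')" using le by (intro sum_mono) auto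
  then have 1: "?P X \<le> exp (\<epsilon> / 2) * ?P X'" by (simp add: sum_distrib_left)
  have "?S X' \<le> (\<Sum>z\<in>G. exp (\<epsilon> / 2) * w z X)" using ge by (intro sum_mono) auto
  then have 2: "?S X' \<le> exp (\<epsilon> / 2) * ?S X" by (simp add: sum_distrib_left)
  have nn: "?P X' \<ge> 0" using pos by (simp add: sum_nonneg less_imp_le)
  have "?P X * ?S X' \<le> (exp (\<epsilon> / 2) * ?P X') * (exp (\<epsilon> / 2) * ?S X)"
    using 1 2 nn S by (intro mult_mono) auto
  also have "\<dots> = exp \<epsilon> * ?P X' * ?S X"
    using exp_add[of "\<epsilon> / 2" "\<epsilon> / 2"] by simp
  finally have "?P X / ?S X \<le> exp \<epsilon> * (?P X' / ?S X')"
    using S by (simp add: field_simps)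
  then show ?thesis by (simp add: measure_finite_mechanism[OF Y])
qed

end

text \<open>Separates the two sources of failure: on the atypical datasets \<open>E\<close> the
  output is bounded by the trivial probability 1, elsewhere only the randomness of the mechanism
  counts.\<close>

lemma measure_bind_ge:
  assumes A: "A \<in> M \<rightarrow>\<^sub>M prob_algebra N" and M: "prob_space M" and G: "G \<in> sets N"
    and E: "E \<in> sets M" "measure M E \<le> b1" and b: "b2 \<ge> 0"
    and good: "\<And>X. X \<in> space M - E \<Longrightarrow> measure (A X) (space N - G) \<le> b2"
  shows "measure (M \<bind> A) G \<ge> 1 - (b1 + b2)"
proof -
  interpret M: prob_space M by fact
  have Mp: "M \<in> space (prob_algebra M)" by (simp add: space_prob_algebra M)
  have sp: "prob_space (A X)" "sets (A X) = sets N" if "X \<in> space M" for X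
    using measurable_space[OF A that] by (auto simp: space_prob_algebra)
  have bp: "prob_space (M \<bind> A)" using prob_space_bind'[OF Mp A] .
  have setsb: "sets (M \<bind> A) = sets N" using sets_bind'[OF Mp A] .
  interpret b: prob_space "M \<bind> A" by (rule bp)
  have "emeasure (M \<bind> A) (space N - G) = (\<integral>\<^sup>+X. emeasure (A X) (space N - G) \<partial>M)"
    by (rule emeasure_bind_prob_algebra[OF Mp A]) (use G in auto)
  also have "\<dots> \<le> (\<integral>\<^sup>+X. indicator E X + ennreal b2 \<partial>M)"
  proof (rule nn_integral_mono)
    fix X assume X: "X \<in> space M"
    interpret p: prob_space "A X" using sp(1)[OF X] .
    show "emeasure (A X) (space N - G) \<le> indicator E X + ennreal b2"
    proof (cases "X \<in> E")
      case True
      have "emeasure (A X) (space N - G) \<le> 1" by (rule p.emeasure_le_1)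
      then show ?thesis using True by (simp add: add_increasing2)
    next
      case False
      then show ?thesis using good[of X] X by (simp add: p.emeasure_eq_measure ennreal_leI)
    qed
  qed
  also have "\<dots> = ennreal (measure M E + b2)"
    using E b by (simp add: nn_integral_add M.emeasure_eq_measure M.prob_space)
  also have "\<dots> \<le> ennreal (b1 + b2)" using E by (intro ennreal_leI) simp
  finally have "measure (M \<bind> A) (space N - G) \<le> b1 + b2"
    using b E(2) order_trans[OF measure_nonneg E(2)] by (simp add: b.emeasure_eq_measure flip: ennreal_plus)
  moreover have "measure (M \<bind> A) (space N - G) = 1 - measure (M \<bind> A) G"
    using b.prob_compl[of G] G setsb sets_eq_imp_space_eq[OF setsb] by simp
  ultimately show ?thesis by simp
qed

section \<open>Nets of directions\<close>

lemma inner_d_le_L2_set: "\<bar>inner_d d u v\<bar> \<le> L2_set u {..<d} * L2_set v {..<d}"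
proof -
  have "\<bar>inner_d d u v\<bar> \<le> (\<Sum>i<d. \<bar>u i\<bar> * \<bar>v i\<bar>)"
    unfolding inner_d_def by (rule order_trans[OF sum_abs]) (simp add: abs_mult)
  also have "\<dots> \<le> L2_set u {..<d} * L2_set v {..<d}" by (rule L2_set_mult_ineq)
  finally show ?thesis .
qed

text \<open>Normalised lattice points of mesh \<open>1 / (4 d)\<close> suffice: coordinatewise
  rounding moves a unit vector by at most 1/4 even in the sum norm. Each coordinate takes
  \<open>8 d + 1 \<le> 9 d\<close> values; the factor 2 pays for closing the net under negation, by
  which lower tails in all directions also give upper tails.\<close>

lemma exists_unit_net:
  assumes d: "d \<ge> 1"
  obtains N where "finite N" "N \<noteq> {}" "\<And>v. v \<in> N \<Longrightarrow> L2_set v {..<d} = 1"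
    "\<And>v. v \<in> N \<Longrightarrow> (\<lambda>i. - v i) \<in> N" "card N \<le> 2 * (9 * d) ^ d"
    "\<And>u. \<exists>v\<in>N. inner_d d u v \<ge> L2_set u {..<d} / 2"
proof -
  define P where "P = (\<Pi>\<^sub>E i\<in>{..<d}. {- int (4 * d)..int (4 * d)})"
  define nrm where "nrm a = L2_set (\<lambda>i. real_of_int (a i)) {..<d}" for a :: "nat \<Rightarrow> int"
  define N0 where "N0 = (\<lambda>a i. real_of_int (a i) / nrm a) ` {a \<in> P. nrm a \<noteq> 0}"
  define N where "N = N0 \<union> (\<lambda>v i. - v i) ` N0"
  have finP: "finite P" unfolding P_def by (intro finite_PiE) auto
  have cardP: "card P \<le> (9 * d) ^ d"
  proof -
    have "card P = (8 * d + 1) ^ d" unfolding P_def by (subst card_PiE) (auto simp: nat_add_distrib nat_mult_distrib)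
    also have "\<dots> \<le> (9 * d) ^ d" using d by (intro power_mono) auto
    finally show ?thesis .
  qed
  have fin0: "finite N0" unfolding N0_def using finP by simp
  have "card N0 \<le> card {a \<in> P. nrm a \<noteq> 0}" unfolding N0_def by (rule card_image_le) (use finP in simp)
  also have "\<dots> \<le> card P" using finP by (intro card_mono) auto
  finally have card0: "card N0 \<le> (9 * d) ^ d" using cardP by linarith
  have unit0: "L2_set v {..<d} = 1" if "v \<in> N0" for v
  proof -
    from that obtain a where a: "nrm a \<noteq> 0" "v = (\<lambda>i. real_of_int (a i) / nrm a)"
      unfolding N0_def by auto
    have "nrm a > 0" using a(1) L2_set_nonneg unfolding nrm_def by (metis less_eq_real_def)
    then show ?thesis
      unfolding a(2) divide_inverse
      using L2_set_left_distrib[of "inverse (nrm a)" "\<lambda>i. real_of_int (a i)" "{..<d}"]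
      by (simp add: nrm_def)
  qed
  have near: "\<exists>v\<in>N0. inner_d d u v \<ge> 1 / 2" if u: "L2_set u {..<d} = 1" for u
  proof -
    define a where "a = (\<lambda>i\<in>{..<d}. \<lfloor>4 * real d * u i\<rfloor>)"
    define e where "e i = real_of_int (a i) / (4 * real d) - u i" for i
    have ui: "\<bar>u i\<bar> \<le> 1" if "i < d" for i
      using member_le_L2_set[of "{..<d}" i "\<lambda>i. \<bar>u i\<bar>"] u that by (simp add: L2_set_def)
    have aP: "a \<in> P"
      unfolding P_def a_def
    proof (intro restrict_PiE_iff[THEN iffD2] ballI)
      fix i assume "i \<in> {..<d}"
      then have "\<bar>u i\<bar> \<le> 1" using ui by simp
      then have "\<bar>4 * real d * u i\<bar> \<le> 4 * real d"
        using mult_left_mono[of "\<bar>u i\<bar>" 1 "4 * real d"] by (simp add: abs_mult)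
      then have "- real (4 * d) \<le> 4 * real d * u i" "4 * real d * u i \<le> real (4 * d)" by auto
      then show "\<lfloor>4 * real d * u i\<rfloor> \<in> {- int (4 * d)..int (4 * d)}"
        by (auto simp: le_floor_iff floor_le_iff)
    qed
    have ei: "\<bar>e i\<bar> \<le> 1 / (4 * real d)" if "i < d" for i
    proof -
      have "e i = (real_of_int (a i) - 4 * real d * u i) / (4 * real d)"
        using d by (simp add: e_def field_simps)
      moreover have "\<bar>real_of_int (a i) - 4 * real d * u i\<bar> \<le> 1"
        using that unfolding a_def by (simp add: abs_le_iff) linarith
      ultimately show ?thesis using d by (simp add: divide_right_mono)
    qed
    have "L2_set e {..<d} \<le> (\<Sum>i<d. \<bar>e i\<bar>)" by (rule L2_set_le_sum_abs)
    also have "\<dots> \<le> (\<Sum>i<d. 1 / (4 * real d))" using ei by (intro sum_mono) auto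
    finally have ne: "L2_set e {..<d} \<le> 1 / 4" using d by simp
    have ae: "real_of_int (a i) = 4 * real d * (u i + e i)" for i using d by (simp add: e_def field_simps)
    have nrm_a: "nrm a = 4 * real d * L2_set (\<lambda>i. u i + e i) {..<d}"
      unfolding nrm_def ae using d by (subst L2_set_right_distrib) auto
    define \<rho> where "\<rho> = L2_set (\<lambda>i. u i + e i) {..<d}"
    have "L2_set (\<lambda>i. u i + e i) {..<d} \<le> L2_set u {..<d} + L2_set e {..<d}" by (rule L2_set_triangle_ineq)
    then have rho_le: "\<rho> \<le> 5 / 4" using ne u by (simp add: \<rho>_def)
    have inner_ue: "\<bar>inner_d d u e\<bar> \<le> 1 / 4"
      using inner_d_le_L2_set[of d u e] ne u by simp
    have uu: "inner_d d u u = 1"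
      using u unfolding L2_set_def inner_d_def by (simp add: power2_eq_square)
    have "inner_d d u (\<lambda>i. u i + e i) = inner_d d u u + inner_d d u e"
      by (simp add: inner_d_def algebra_simps sum.distrib)
    then have in_ge: "inner_d d u (\<lambda>i. u i + e i) \<ge> 3 / 4" using inner_ue uu by linarith
    have "inner_d d u (\<lambda>i. u i + e i) \<le> (\<Sum>i<d. \<bar>u i\<bar> * \<bar>u i + e i\<bar>)"
      unfolding inner_d_def by (intro sum_mono) (simp flip: abs_mult)
    also have "\<dots> \<le> L2_set u {..<d} * \<rho>" unfolding \<rho>_def by (rule L2_set_mult_ineq)
    finally have rho_ge: "\<rho> \<ge> 3 / 4" using in_ge u by simp
    let ?v = "\<lambda>i. real_of_int (a i) / nrm a"
    have n0: "nrm a \<noteq> 0" using nrm_a rho_ge d by (simp add: \<rho>_def)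
    have veq: "?v i = (u i + e i) / \<rho>" for i
      unfolding nrm_a ae using d by (simp add: \<rho>_def)
    have "inner_d d u ?v = inner_d d u (\<lambda>i. u i + e i) / \<rho>"
      unfolding veq by (simp add: inner_d_def sum_divide_distrib)
    \<comment> \<open>The quotient is at least (3/4) / (5/4) = 3/5.\<close>
    also have "\<dots> \<ge> 1 / 2"
      using in_ge rho_le rho_ge by (simp add: field_simps)
    finally have "inner_d d u ?v \<ge> 1 / 2" .
    moreover have "?v \<in> N0" unfolding N0_def using aP n0 by auto
    ultimately show ?thesis by blast
  qed
  \<comment> \<open>Any unit vector shows that the net is nonempty; this one exists because
    \<open>d \<ge> 1\<close>. Nonemptiness settles the zero vector below and makes the maximum in
    the score meaningful.\<close>
  have "L2_set (\<lambda>i. if i = 0 then 1 else 0) {..<d} = 1"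
    unfolding L2_set_def using d by (simp add: if_distrib[of "\<lambda>x. x\<^sup>2"] cong: if_cong)
  from near[OF this] have ne0: "N0 \<noteq> {}" by auto
  have near': "\<exists>v\<in>N0. inner_d d u v \<ge> L2_set u {..<d} / 2" for u
  proof (cases "L2_set u {..<d} = 0")
    case True
    then have "\<And>i. i < d \<Longrightarrow> u i = 0" by (simp add: L2_set_eq_0_iff)
    then have "inner_d d u v = 0" for v by (simp add: inner_d_def)
    then show ?thesis using True ne0 by auto
  next
    case False
    define r where "r = L2_set u {..<d}"
    have r: "r > 0" using False L2_set_nonneg[of u "{..<d}"] unfolding r_def by linarith
    have "L2_set (\<lambda>i. inverse r * u i) {..<d} = inverse r * r"
      unfolding r_def by (subst L2_set_right_distrib) (auto simp: L2_set_nonneg)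
    then have "L2_set (\<lambda>i. inverse r * u i) {..<d} = 1" using r by simp
    from near[OF this] obtain v where v: "v \<in> N0" "inner_d d (\<lambda>i. inverse r * u i) v \<ge> 1 / 2" by auto
    have "inner_d d (\<lambda>i. inverse r * u i) v = inverse r * inner_d d u v"
      by (simp add: inner_d_def sum_distrib_left mult.assoc)
    then have "inverse r * inner_d d u v \<ge> 1 / 2" using v by simp
    then have "inner_d d u v \<ge> r / 2" using r by (simp add: field_simps)
    then show ?thesis using v r_def by auto
  qed
  show ?thesis
  proof (rule that[of N])
    show "finite N" "N \<noteq> {}" using fin0 ne0 by (auto simp: N_def)
    show "L2_set v {..<d} = 1" if "v \<in> N" for v
      using that unit0 unfolding N_def by (auto simp: L2_set_def)
    show "(\<lambda>i. - v i) \<in> N" if "v \<in> N" for v using that by (auto simp: N_def)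
    have "card N \<le> card N0 + card ((\<lambda>v i. - v i) ` N0)" unfolding N_def by (rule card_Un_le)
    also have "\<dots> \<le> card N0 + card N0" using card_image_le[OF fin0] by simp
    finally show "card N \<le> 2 * (9 * d) ^ d" using card0 by simp
    show "\<exists>v\<in>N. inner_d d u v \<ge> L2_set u {..<d} / 2" for u
      using near'[of u] by (auto simp: N_def)
  qed
qed

section \<open>Clipping\<close>

definition clip :: "real \<Rightarrow> real \<Rightarrow> real" where
  "clip \<tau> z = max (- \<tau>) (min \<tau> z)"

text \<open>
  The asymmetric clipping is the pointwise infimum of \<open>clip \<tau> (z + s) - s\<close> over \<open>0 \<le> s \<le> \<tau> / 2\<close>, so that
  one concentration bound per direction controls the scores of all candidates at once.
\<close>

definition skew_clip :: "real \<Rightarrow> real \<Rightarrow> real" where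
  "skew_clip \<tau> z = max (- (3 * \<tau> / 2)) (min (\<tau> / 2) z)"

lemma clip_shift_ge: "\<tau> > 0 \<Longrightarrow> s \<ge> 0 \<Longrightarrow> clip \<tau> (z + s) \<ge> min s (\<tau> / 2) + skew_clip \<tau> z"
  unfolding clip_def skew_clip_def by (simp add: min_def max_def)

text \<open>The mirror image of the lower bound: \<open>- skew_clip \<tau> (- z)\<close> clips
  \<open>z\<close> to the interval from \<open>-\<tau>/2\<close> to \<open>3\<tau>/2\<close>. Thus
  an upper bound for a score also follows from a lower tail of \<open>skew_clip\<close>.\<close>

lemma clip_shift_le: "\<tau> > 0 \<Longrightarrow> clip \<tau> (z + s) \<le> \<bar>s\<bar> - skew_clip \<tau> (- z)"
  unfolding clip_def skew_clip_def by (auto simp: min_def max_def)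

lemma abs_clip_le: "\<tau> > 0 \<Longrightarrow> \<bar>clip \<tau> z\<bar> \<le> \<tau>"
  unfolding clip_def by (auto simp: min_def max_def)

lemma clip_measurable [measurable]: "clip \<tau> \<in> borel_measurable borel"
  unfolding clip_def by measurable

lemma skew_clip_measurable [measurable]: "skew_clip \<tau> \<in> borel_measurable borel"
  unfolding skew_clip_def by measurable

section \<open>Clipped batch means\<close>

text \<open>Taylor's formula with Lagrange remainder at an intermediate point \<open>t\<close>. For
  negative \<open>y\<close> the library bound \<open>\<bar>t\<bar> \<le> \<bar>y\<bar>\<close> would
  not give \<open>t \<le> c\<close>, so that case uses the version that locates \<open>t\<close>
  below 0.\<close>

lemma exp_le_quadratic:
  fixes y c :: real
  assumes "y \<le> c" "0 \<le> c"
  shows "exp y \<le> 1 + y + exp c * y\<^sup>2 / 2"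
proof (cases "y < 0")
  case True
  have "\<exists>t>y. t < 0 \<and> exp y = (\<Sum>m<2. exp 0 / fact m * y ^ m) + exp t / fact 2 * y ^ 2"
    by (rule Maclaurin_minus[where diff = "\<lambda>_. exp"]) (use True in auto)
  then obtain t where t: "t < 0" "exp y = 1 + y + exp t / 2 * y\<^sup>2"
    by (auto simp: numeral_2_eq_2)
  have "exp t / 2 * y\<^sup>2 \<le> exp c / 2 * y\<^sup>2"
    using t assms by (intro mult_right_mono) auto
  then show ?thesis using t by simp
next
  case False
  obtain t where t: "\<bar>t\<bar> \<le> \<bar>y\<bar>" "exp y = (\<Sum>m<2. y ^ m / fact m) + exp t / fact 2 * y ^ 2"
    using Maclaurin_exp_le[of y 2] by auto
  have "exp t / 2 * y\<^sup>2 \<le> exp c / 2 * y\<^sup>2"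
    using t assms False by (intro mult_right_mono) auto
  then show ?thesis using t by (simp add: numeral_2_eq_2)
qed

text \<open>
  Up to \<open>k / \<theta>\<close> the exponential is compared with its Taylor polynomial; beyond, \<open>u \<mapsto> exp (\<theta> u) / u\<^sup>k\<close>
  is increasing.
\<close>

lemma exp_truncated_le:
  fixes x B \<theta> k :: real
  assumes x: "\<bar>x\<bar> \<le> B" and B: "B > 0" and \<theta>: "\<theta> > 0" and k: "k > 0"
  shows "exp (\<theta> * x) \<le> 1 + \<theta> * x + exp k * \<theta>\<^sup>2 / 2 * x\<^sup>2 + exp (\<theta> * B) / B powr k * \<bar>x\<bar> powr k"
proof (cases "\<theta> * x \<le> k")
  case True
  have "exp (\<theta> * x) \<le> 1 + \<theta> * x + exp k * (\<theta> * x)\<^sup>2 / 2"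
    using True k by (intro exp_le_quadratic) auto
  also have "exp k * (\<theta> * x)\<^sup>2 / 2 = exp k * \<theta>\<^sup>2 / 2 * x\<^sup>2"
    by (simp add: power_mult_distrib)
  also have "1 + \<theta> * x + exp k * \<theta>\<^sup>2 / 2 * x\<^sup>2
      \<le> 1 + \<theta> * x + exp k * \<theta>\<^sup>2 / 2 * x\<^sup>2 + exp (\<theta> * B) / B powr k * \<bar>x\<bar> powr k" by simp
  finally show ?thesis .
next
  case False
  then have x0: "x > 0" using \<theta> k by (smt (verit) mult_nonneg_nonpos)
  have "ln (B / x) \<le> B / x - 1" using B x0 by (intro ln_le_minus_one) auto
  then have "k * ln (B / x) \<le> k * (B / x - 1)" using k by (intro mult_left_mono) auto
  also have "\<dots> = k / x * (B - x)" using x0 by (simp add: field_simps)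
  also have "\<dots> \<le> \<theta> * (B - x)"
    using False x x0 by (intro mult_right_mono) (auto simp: field_simps)
  finally have "\<theta> * x \<le> \<theta> * B - k * ln (B / x)" by (simp add: algebra_simps)
  then have "exp (\<theta> * x) \<le> exp (\<theta> * B - k * ln (B / x))" by simp
  also have "\<dots> = exp (\<theta> * B) / B powr k * \<bar>x\<bar> powr k"
    using B x0 by (simp add: powr_def exp_diff ln_div right_diff_distrib)
  finally have "exp (\<theta> * x) \<le> exp (\<theta> * B) / B powr k * \<bar>x\<bar> powr k" .
  moreover have "1 + \<theta> * x + exp k * \<theta>\<^sup>2 / 2 * x\<^sup>2 \<ge> 0"
    using \<theta> x0 by (simp add: add_nonneg_nonneg)
  ultimately show ?thesis by linarith
qed

text \<open>Fitted to \<open>exists_chernoff_parameter\<close>: its variance regime needs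
  \<open>K^2 / (32 exp k) \<ge> 2 k + 5\<close>, and its other regime is covered by
  \<open>K \<ge> 160\<close>.\<close>

definition tail_const :: "real \<Rightarrow> real" where
  "tail_const k = 32 * exp k * (2 * k + 5)"

lemma tail_const_ge: "k \<ge> 0 \<Longrightarrow> tail_const k \<ge> 160"
proof -
  assume k: "k \<ge> 0"
  have "32 * 1 * 5 \<le> 32 * exp k * (2 * k + 5)" using k by (intro mult_mono) auto
  then show ?thesis by (simp add: tail_const_def)
qed

text \<open>The choice of parameter in the Fuk-Nagaev argument. The first entry of the minimum
  \<open>\<theta>\<close> keeps the variance part of the exponent below
  \<open>\<theta> T / 8\<close>; the second keeps the \<open>k\<close>-th moment part below 1. The
  last property makes the resulting Chernoff bound no larger than the order \<open>m B^(1-k)\<close>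
  of the mass lost by truncating \<open>m\<close> variables at \<open>B\<close>.\<close>

lemma exists_chernoff_parameter:
  fixes k m B T :: real
  assumes k: "k \<ge> 2" and m: "m \<ge> 1" and B: "B \<ge> 1" and Bk: "B powr k \<ge> exp 1 * m"
    and TB: "T \<ge> tail_const k * B" and Tm: "T \<ge> tail_const k * sqrt (m * ln m)"
  obtains \<theta> where "\<theta> > 0" "m * (exp k * \<theta>\<^sup>2 / 2) \<le> \<theta> * T / 8" "m * (exp (\<theta> * B) / B powr k) \<le> 1"
    "2 / \<theta> * exp (1 - \<theta> * T / 4) \<le> m * B powr (1 - k)"
proof -
  define a where "a = exp k"
  define L where "L = ln (B powr k / m)"
  define K where "K = tail_const k"
  define \<theta> where "\<theta> = min (T / (4 * m * a)) (L / B)"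
  have a: "a \<ge> 1" using k by (simp add: a_def)
  have K: "K \<ge> 160" using tail_const_ge[of k] k by (simp add: K_def)
  have T: "T \<ge> K * B" "T \<ge> K * sqrt (m * ln m)" using TB Tm by (auto simp: K_def)
  have TB': "T \<ge> B" using T(1) K B mult_right_mono[of 1 K B] by linarith
  then have T0: "T > 0" using B by linarith
  have L1: "L \<ge> 1"
  proof -
    have "exp 1 \<le> B powr k / m" using Bk m by (simp add: field_simps)
    then have "ln (exp 1) \<le> L" unfolding L_def by (intro ln_mono) auto
    then show ?thesis by simp
  qed
  have eL: "exp L = B powr k / m" using m B by (simp add: L_def)
  have \<theta>0: "\<theta> > 0" using T0 m a L1 B by (simp add: \<theta>_def)
  have p1: "m * (exp k * \<theta>\<^sup>2 / 2) \<le> \<theta> * T / 8"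
  proof -
    have "\<theta> \<le> T / (4 * m * a)" by (simp add: \<theta>_def)
    then have "4 * m * a * \<theta> \<le> T" using m a by (simp add: field_simps)
    then have "4 * m * a * \<theta> * \<theta> \<le> T * \<theta>" using \<theta>0 by (intro mult_right_mono) auto
    then show ?thesis by (simp add: a_def power2_eq_square algebra_simps)
  qed
  have p2: "m * (exp (\<theta> * B) / B powr k) \<le> 1"
  proof -
    have "\<theta> * B \<le> L" using B \<theta>_def by (simp add: min_def field_simps split: if_splits)
    then have "exp (\<theta> * B) \<le> B powr k / m" unfolding eL[symmetric] by simp
    then show ?thesis using m B by (simp add: field_simps)
  qed
  \<comment> \<open>The last property after taking logarithms, since
    \<open>ln (m B^(1-k)) = ln B - L\<close>.\<close>
  have main: "\<theta> * T / 4 \<ge> L + 1 + ln 2 - ln (\<theta> * B)"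
  proof (cases "L / B \<le> T / (4 * m * a)")
    case True
    then have th: "\<theta> * B = L" using B by (simp add: \<theta>_def)
    have "\<theta> * T \<ge> \<theta> * (K * B)" using T \<theta>0 by (intro mult_left_mono) auto
    moreover have "\<theta> * (K * B) = K * L" unfolding th[symmetric] by simp
    ultimately have "\<theta> * T \<ge> K * L" by simp
    moreover have "K * L \<ge> 160 * L" using K L1 by (intro mult_right_mono) auto
    moreover have "ln L \<ge> 0" using L1 by simp
    moreover have "ln 2 \<le> (1::real)" using ln_le_minus_one[of 2] by simp
    ultimately show ?thesis unfolding th using L1 by linarith
  next
    case False
    then have th: "\<theta> = T / (4 * m * a)" by (simp add: \<theta>_def)
    \<comment> \<open>The squared ratio of the truncation level to the standard deviation scale
      \<open>sqrt m\<close> of a batch sum. The two lower bounds on \<open>T\<close> average to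
      \<open>T^2 / m \<ge> K^2 (q + ln m) / 2\<close>, so in this regime everything is compared with
      \<open>q + ln m\<close>.\<close>
    define q where "q = B\<^sup>2 / m"
    have q0: "q > 0" using B m by (simp add: q_def)
    have lm: "ln m \<ge> 0" using m by simp
    have lq: "ln q = 2 * ln B - ln m" using B m by (simp add: q_def ln_div ln_realpow)
    have qm: "q + ln m \<ge> 1"
    proof -
      have "q \<ge> 1 / m" using B m unfolding q_def by (intro divide_right_mono) (auto simp: one_le_power)
      moreover have "ln (1 / m) \<le> 1 / m - 1" using m by (intro ln_le_minus_one) auto
      ultimately show ?thesis using m by (simp add: ln_div)
    qed
    have T2: "T\<^sup>2 \<ge> K\<^sup>2 * B\<^sup>2" "T\<^sup>2 \<ge> K\<^sup>2 * (m * ln m)"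
    proof -
      show "T\<^sup>2 \<ge> K\<^sup>2 * B\<^sup>2"
        using power_mono[OF T(1), of 2] K B by (simp add: power_mult_distrib)
      show "T\<^sup>2 \<ge> K\<^sup>2 * (m * ln m)"
        using power_mono[OF T(2), of 2] K lm m by (simp add: power_mult_distrib)
    qed
    have "T\<^sup>2 / m \<ge> K\<^sup>2 * (q + ln m) / 2"
    proof -
      have "K\<^sup>2 * q \<le> T\<^sup>2 / m" "K\<^sup>2 * ln m \<le> T\<^sup>2 / m"
        using T2 m by (simp_all add: q_def field_simps)
      then show ?thesis by (simp add: algebra_simps)
    qed
    then have "T\<^sup>2 / m / (16 * a) \<ge> K\<^sup>2 * (q + ln m) / 2 / (16 * a)"
      using a by (intro divide_right_mono) auto
    then have 1: "\<theta> * T / 4 \<ge> K\<^sup>2 / (32 * a) * (q + ln m)"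
      by (simp add: th power2_eq_square mult.assoc mult.left_commute mult.commute[of a])
    have "K\<^sup>2 / (32 * a) = 32 * a * (2 * k + 5)\<^sup>2"
      using a by (simp add: K_def tail_const_def a_def[symmetric] power2_eq_square field_simps)
    also have "\<dots> \<ge> 1 * (2 * k + 5)\<^sup>2" using a by (intro mult_right_mono) auto
    also have "1 * (2 * k + 5)\<^sup>2 \<ge> 2 * k + 5"
      using k by (simp add: power2_eq_square algebra_simps)
    finally have "K\<^sup>2 / (32 * a) * (q + ln m) \<ge> (2 * k + 5) * (q + ln m)"
      using qm by (intro mult_right_mono) auto
    with 1 have 2: "\<theta> * T / 4 \<ge> (2 * k + 5) * (q + ln m)" by linarith
    have L: "L = k / 2 * ln q + (k / 2 - 1) * ln m"
      using B m by (simp add: L_def lq ln_div ln_powr algebra_simps)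
    have "ln q \<le> q" using q0 ln_le_minus_one[of q] by linarith
    then have "k / 2 * ln q \<le> k / 2 * q" using k by (intro mult_left_mono) auto
    \<comment> \<open>The spare \<open>- ln m\<close> is kept because it cancels the
      \<open>ln m\<close> in the bound on \<open>- ln (\<theta> * B)\<close> below.\<close>
    then have 3: "L \<le> k / 2 * (q + ln m) - ln m" unfolding L by (simp add: algebra_simps)
    have "B * B \<le> T * B" using TB' B by (intro mult_right_mono) auto
    then have "q / (4 * a) \<le> \<theta> * B"
      using m a by (simp add: th q_def power2_eq_square field_simps)
    then have "ln (q / (4 * a)) \<le> ln (\<theta> * B)" using q0 a by (intro ln_mono) auto
    moreover have "ln (q / (4 * a)) = ln q - ln 4 - k"
      using q0 a by (simp add: ln_div ln_mult a_def)
    moreover have "ln q \<ge> - ln m" using B by (simp add: lq)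
    moreover have "ln 4 \<le> (3::real)" "ln 2 \<le> (1::real)"
      using ln_le_minus_one[of 4] ln_le_minus_one[of 2] by auto
    ultimately have "- ln (\<theta> * B) \<le> ln m + 3 + k" "ln 2 \<le> (1::real)" by linarith+
    then have "L + 1 + ln 2 - ln (\<theta> * B) \<le> k / 2 * (q + ln m) + (5 + k) * 1"
      using 3 by simp
    also have "\<dots> \<le> k / 2 * (q + ln m) + (5 + k) * (q + ln m)"
      using qm k by (intro add_left_mono mult_left_mono) auto
    also have "\<dots> \<le> (2 * k + 5) * (q + ln m)"
    proof -
      have "k * (q + ln m) \<ge> 0" using k qm by (intro mult_nonneg_nonneg) linarith+
      then show ?thesis by (simp add: algebra_simps)
    qed
    finally show ?thesis using 2 by linarith
  qed
  have "exp (1 - \<theta> * T / 4) \<le> exp (ln (\<theta> * B) - ln 2 - L)" using main by simp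
  also have "\<dots> = \<theta> * B / 2 * (m / B powr k)" using \<theta>0 B eL by (simp add: exp_diff)
  finally have "2 / \<theta> * exp (1 - \<theta> * T / 4) \<le> 2 / \<theta> * (\<theta> * B / 2 * (m / B powr k))"
    using \<theta>0 by (intro mult_left_mono) auto
  also have "\<dots> = m * B powr (1 - k)" using \<theta>0 B by (simp add: powr_diff field_simps)
  finally have p3: "2 / \<theta> * exp (1 - \<theta> * T / 4) \<le> m * B powr (1 - k)" .
  show ?thesis by (rule that[OF \<theta>0 p1 p2 p3])
qed

section \<open>Truncation and expected overshoot of batch sums of a single projection\<close>

locale centred_moment = prob_space D for D :: "'a measure" +
  fixes f :: "'a \<Rightarrow> real" and k :: real
  assumes k: "k \<ge> 2" and meas [measurable]: "f \<in> borel_measurable D"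
    and moment: "(\<integral>\<^sup>+x. ennreal (\<bar>f x\<bar> powr k) \<partial>D) \<le> 1" and mean: "expectation f = 0"
begin

lemma integrable_moment: "integrable D (\<lambda>x. \<bar>f x\<bar> powr k)"
proof (rule integrableI_bounded)
  show "(\<integral>\<^sup>+x. ennreal (norm (\<bar>f x\<bar> powr k)) \<partial>D) < \<infinity>"
    using moment by (simp add: order_le_less_trans[OF _ ennreal_one_less_top])
qed measurable

lemma moment_le: "expectation (\<lambda>x. \<bar>f x\<bar> powr k) \<le> 1"
  using moment nn_integral_eq_integral[OF integrable_moment] by simp

text \<open>With \<open>z = \<bar>f x\<bar> powr k\<close>, the square is
  \<open>z powr (2 / k)\<close>, a concave function of \<open>z\<close> because
  \<open>k \<ge> 2\<close>, and the right side is its tangent at \<open>z = 1\<close>. Taking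
  expectations gives both integrability of the square and variance at most 1.\<close>

lemma square_le: "(f x)\<^sup>2 \<le> 1 + (2 / k) * (\<bar>f x\<bar> powr k - 1)"
proof (cases "f x = 0")
  case True
  then show ?thesis using k by simp
next
  case False
  define z where "z = \<bar>f x\<bar> powr k"
  have z: "z > 0" using False by (simp add: z_def)
  have "(f x)\<^sup>2 = z powr (2 / k)"
    using k False by (simp add: z_def powr_powr)
  moreover have "z powr (2 / k) \<le> 1 + 2 / k * (z - 1)"
    using Youngs_inequality_0[of "2 / k" "1 - 2 / k" z 1] z k
    by (simp add: algebra_simps diff_divide_distrib)
  ultimately show ?thesis by (simp add: z_def)
qed

lemma integrable_square: "integrable D (\<lambda>x. (f x)\<^sup>2)"
proof (rule Bochner_Integration.integrable_bound)
  show "integrable D (\<lambda>x. 1 + (2 / k) * (\<bar>f x\<bar> powr k - 1))"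
    using integrable_moment by simp
  show "AE x in D. norm ((f x)\<^sup>2) \<le> norm (1 + (2 / k) * (\<bar>f x\<bar> powr k - 1))"
    using square_le by (intro AE_I2) (smt (verit) real_norm_def zero_le_power2)
qed measurable

lemma second_moment_le: "expectation (\<lambda>x. (f x)\<^sup>2) \<le> 1"
proof -
  have "expectation (\<lambda>x. (f x)\<^sup>2) \<le> expectation (\<lambda>x. 1 + (2 / k) * (\<bar>f x\<bar> powr k - 1))"
    using integrable_square integrable_moment square_le by (intro integral_mono) auto
  also have "\<dots> = 1 + 2 / k * (expectation (\<lambda>x. \<bar>f x\<bar> powr k) - 1)"
    using integrable_moment by (simp add: prob_space)
  also have "\<dots> \<le> 1"
  proof -
    have "2 / k * (expectation (\<lambda>x. \<bar>f x\<bar> powr k) - 1) \<le> 0"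
      using moment_le k by (intro mult_nonneg_nonpos) auto
    then show ?thesis by linarith
  qed
  finally show ?thesis .
qed

lemma integrable_f: "integrable D f"
  using square_integrable_imp_integrable[OF meas integrable_square] .

definition trunc :: "real \<Rightarrow> 'a \<Rightarrow> real" where
  "trunc B x = (if \<bar>f x\<bar> \<le> B then f x else 0)"

definition excess :: "real \<Rightarrow> 'a \<Rightarrow> real" where
  "excess B x = (if \<bar>f x\<bar> \<le> B then 0 else \<bar>f x\<bar>)"

lemma trunc_measurable [measurable]: "trunc B \<in> borel_measurable D"
  unfolding trunc_def by measurable

lemma excess_measurable [measurable]: "excess B \<in> borel_measurable D"
  unfolding excess_def by measurable

lemma excess_nonneg: "excess B x \<ge> 0" by (simp add: excess_def)

lemma excess_le:
  assumes "B > 0" shows "excess B x \<le> B powr (1 - k) * \<bar>f x\<bar> powr k"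
proof (cases "\<bar>f x\<bar> \<le> B")
  case False
  then have "\<bar>f x\<bar> = \<bar>f x\<bar> powr (1 - k) * \<bar>f x\<bar> powr k" using assms by (simp flip: powr_add)
  also have "\<dots> \<le> B powr (1 - k) * \<bar>f x\<bar> powr k"
    using False assms k by (intro mult_right_mono powr_mono2') auto
  finally show ?thesis using False by (simp add: excess_def)
qed (simp add: excess_def)

lemma integrable_excess: "B > 0 \<Longrightarrow> integrable D (excess B)"
  by (rule Bochner_Integration.integrable_bound[OF integrable_mult_right[OF integrable_moment, of "B powr (1 - k)"]])
     (use excess_le[of B] excess_nonneg[of B] in \<open>auto intro!: AE_I2\<close>)

lemma expectation_excess_le:
  assumes "B > 0" shows "expectation (excess B) \<le> B powr (1 - k)"
proof -
  have "expectation (excess B) \<le> expectation (\<lambda>x. B powr (1 - k) * \<bar>f x\<bar> powr k)"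
    using integrable_excess[OF assms] excess_le[OF assms] integrable_moment by (intro integral_mono) auto
  also have "\<dots> = B powr (1 - k) * expectation (\<lambda>x. \<bar>f x\<bar> powr k)" by simp
  also have "\<dots> \<le> B powr (1 - k)" using moment_le by (intro mult_left_le) auto
  finally show ?thesis .
qed

lemma integrable_trunc: "B > 0 \<Longrightarrow> integrable D (trunc B)"
  by (rule integrable_const_bound[of _ B]) (auto simp: trunc_def intro!: AE_I2)

text \<open>As \<open>f\<close> is centred, truncation shifts the mean by no more than the
  expectation of the part cut off.\<close>

lemma expectation_trunc_le:
  assumes B: "B > 0" shows "expectation (trunc B) \<le> B powr (1 - k)"
proof -
  have "expectation (trunc B) - expectation f = expectation (\<lambda>x. trunc B x - f x)"
    using integrable_trunc[OF B] integrable_f by simp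
  also have "\<dots> \<le> expectation (excess B)"
  proof (rule integral_mono)
    show "integrable D (\<lambda>x. trunc B x - f x)" "integrable D (excess B)"
      using integrable_trunc[OF B] integrable_f integrable_excess[OF B] by auto
  qed (auto simp: trunc_def excess_def)
  finally show ?thesis using mean expectation_excess_le[OF B] by simp
qed

text \<open>The three summands of the exponent are the linear term (bias of truncation), the
  quadratic term (variance) and the power term (\<open>k\<close>-th moment) of
  \<open>exp_truncated_le\<close>. Writing the bound as an exponential lets it multiply over a
  batch.\<close>

lemma mgf_trunc_le:
  assumes B: "B > 0" and \<theta>: "\<theta> > 0"
  shows "(\<integral>\<^sup>+x. ennreal (exp (\<theta> * trunc B x)) \<partial>D)
     \<le> ennreal (exp (\<theta> * B powr (1 - k) + exp k * \<theta>\<^sup>2 / 2 + exp (\<theta> * B) / B powr k))"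
proof -
  let ?c = "exp (\<theta> * B) / B powr k"
  let ?g = "\<lambda>x. 1 + \<theta> * trunc B x + exp k * \<theta>\<^sup>2 / 2 * (f x)\<^sup>2 + ?c * \<bar>f x\<bar> powr k"
  have le: "exp (\<theta> * trunc B x) \<le> ?g x" for x
  proof -
    have "exp (\<theta> * trunc B x) \<le> 1 + \<theta> * trunc B x + exp k * \<theta>\<^sup>2 / 2 * (trunc B x)\<^sup>2 + ?c * \<bar>trunc B x\<bar> powr k"
      using B \<theta> k by (intro exp_truncated_le) (auto simp: trunc_def)
    also have "\<dots> \<le> ?g x"
      by (intro add_mono order_refl mult_left_mono) (auto simp: trunc_def)
    finally show ?thesis .
  qed
  have int: "integrable D ?g"
    using integrable_trunc[OF B] integrable_square integrable_moment by auto
  have "(\<integral>\<^sup>+x. ennreal (exp (\<theta> * trunc B x)) \<partial>D) \<le> (\<integral>\<^sup>+x. ennreal (?g x) \<partial>D)"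
    using le by (intro nn_integral_mono ennreal_leI)
  also have "\<dots> = ennreal (expectation ?g)"
    using int le by (intro nn_integral_eq_integral AE_I2) (auto intro: order_trans[OF exp_ge_zero])
  also have "expectation ?g = 1 + \<theta> * expectation (trunc B)
      + exp k * \<theta>\<^sup>2 / 2 * expectation (\<lambda>x. (f x)\<^sup>2) + ?c * expectation (\<lambda>x. \<bar>f x\<bar> powr k)"
    using integrable_trunc[OF B] integrable_square integrable_moment by (simp add: prob_space)
  also have "ennreal \<dots> \<le> ennreal (1 + \<theta> * B powr (1 - k) + exp k * \<theta>\<^sup>2 / 2 * 1 + ?c * 1)"
    using expectation_trunc_le[OF B] second_moment_le moment_le \<theta>
    by (intro ennreal_leI add_mono mult_left_mono) auto
  also have "\<dots> \<le> ennreal (exp (\<theta> * B powr (1 - k) + exp k * \<theta>\<^sup>2 / 2 + ?c))"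
  proof (rule ennreal_leI)
    have "1 + a + b * 1 + c * 1 \<le> exp (a + b + c)" for a b c :: real
      using exp_ge_add_one_self[of "a + b + c"] by linarith
    then show "1 + \<theta> * B powr (1 - k) + exp k * \<theta>\<^sup>2 / 2 * 1 + ?c * 1
        \<le> exp (\<theta> * B powr (1 - k) + exp k * \<theta>\<^sup>2 / 2 + ?c)" .
  qed
  finally show ?thesis .
qed

text \<open>Chernoff's method for an expected overshoot: the positive part of \<open>s - T\<close>
  is below \<open>exp (\<theta> * (s - T)) / \<theta>\<close>, and the exponential factorises by
  independence.\<close>

lemma sum_trunc_tail_le:
  assumes B: "B > 0" and \<theta>: "\<theta> > 0"
  shows "(\<integral>\<^sup>+b. ennreal (max 0 ((\<Sum>j<m. trunc B (b j)) - T)) \<partial>(\<Pi>\<^sub>M j\<in>{..<m}. D))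
     \<le> ennreal (1 / \<theta> * exp (real m * (\<theta> * B powr (1 - k) + exp k * \<theta>\<^sup>2 / 2 + exp (\<theta> * B) / B powr k) - \<theta> * T))"
    (is "?lhs \<le> ennreal (1 / \<theta> * exp (real m * ?e - \<theta> * T))")
proof -
  interpret P: product_prob_space "\<lambda>_. D" "{..<m}" by unfold_locales
  have pt: "max 0 (s - T) \<le> 1 / \<theta> * exp (- \<theta> * T) * exp (\<theta> * s)" for s
  proof -
    have "\<theta> * (s - T) \<le> exp (\<theta> * (s - T))" using exp_ge_add_one_self[of "\<theta> * (s - T)"] by linarith
    then have "s - T \<le> 1 / \<theta> * exp (\<theta> * (s - T))" using \<theta> by (simp add: field_simps)
    then show ?thesis using \<theta> by (simp add: algebra_simps exp_diff exp_minus field_simps)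
  qed
  have "?lhs \<le> (\<integral>\<^sup>+b. ennreal (1 / \<theta> * exp (- \<theta> * T)) * (\<Prod>j<m. ennreal (exp (\<theta> * trunc B (b j)))) \<partial>(\<Pi>\<^sub>M j\<in>{..<m}. D))"
  proof (rule nn_integral_mono)
    fix b
    have "(\<Prod>j<m. ennreal (exp (\<theta> * trunc B (b j)))) = ennreal (exp (\<theta> * (\<Sum>j<m. trunc B (b j))))"
      by (simp add: prod_ennreal exp_sum sum_distrib_left)
    then show "ennreal (max 0 ((\<Sum>j<m. trunc B (b j)) - T)) \<le>
        ennreal (1 / \<theta> * exp (- \<theta> * T)) * (\<Prod>j<m. ennreal (exp (\<theta> * trunc B (b j))))"
      using pt[of "\<Sum>j<m. trunc B (b j)"] \<theta>
      by (simp add: ennreal_mult[symmetric] ennreal_leI del: max.bounded_iff)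
  qed
  also have "\<dots> = ennreal (1 / \<theta> * exp (- \<theta> * T)) * (\<integral>\<^sup>+b. (\<Prod>j<m. ennreal (exp (\<theta> * trunc B (b j)))) \<partial>(\<Pi>\<^sub>M j\<in>{..<m}. D))"
    by (intro nn_integral_cmult) measurable
  also have "(\<integral>\<^sup>+b. (\<Prod>j<m. ennreal (exp (\<theta> * trunc B (b j)))) \<partial>(\<Pi>\<^sub>M j\<in>{..<m}. D))
      = (\<Prod>j<m. \<integral>\<^sup>+x. ennreal (exp (\<theta> * trunc B x)) \<partial>D)"
    by (rule P.product_nn_integral_prod) auto
  also have "\<dots> \<le> (\<Prod>j<m. ennreal (exp ?e))"
    using mgf_trunc_le[OF B \<theta>] by (intro prod_mono_ennreal) auto
  also have "\<dots> = ennreal (exp (real m * ?e))" by (simp add: exp_of_nat_mult ennreal_power)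
  also have "ennreal (1 / \<theta> * exp (- \<theta> * T)) * ennreal (exp (real m * ?e)) = ennreal (1 / \<theta> * exp (real m * ?e - \<theta> * T))"
  proof -
    have "1 / \<theta> * exp (- \<theta> * T) * exp E = 1 / \<theta> * exp (E - \<theta> * T)" for E
      by (simp add: exp_diff exp_minus field_simps)
    then show ?thesis using \<theta> by (subst ennreal_mult[symmetric]) auto
  qed
  finally show ?thesis by (simp add: mult_left_mono)
qed

lemma distr_component: "j < m \<Longrightarrow> distr (\<Pi>\<^sub>M j\<in>{..<m}. D) D (\<lambda>b. b j) = D"
  using prob_space_axioms by (intro distr_PiM_component) auto

lemma nn_integral_component:
  assumes "j < m" "g \<in> borel_measurable D"
  shows "(\<integral>\<^sup>+b. g (b j) \<partial>(\<Pi>\<^sub>M j\<in>{..<m}. D)) = (\<integral>\<^sup>+x. g x \<partial>D)"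
  using nn_integral_distr[of "\<lambda>b. b j" "\<Pi>\<^sub>M j\<in>{..<m}. D" D g] assms by (simp add: distr_component)

lemma centred_moment_uminus: "centred_moment D (\<lambda>x. - f x) k"
  by unfold_locales (use k moment mean in auto)

text \<open>The overshoot of the batch sum splits into the overshoots of the truncated sums of
  \<open>f\<close> and of \<open>- f\<close>, each at most \<open>m B^(1-k) / 2\<close>, and the
  mass \<open>m B^(1-k)\<close> removed by truncation.\<close>

lemma sum_tail_le:
  assumes m: "m \<ge> 1" and B: "B \<ge> 1" and Bk: "B powr k \<ge> exp 1 * real m"
    and TB: "T \<ge> tail_const k * B" and Tm: "T \<ge> tail_const k * sqrt (real m * ln (real m))"
  shows "(\<integral>\<^sup>+b. ennreal (max 0 (\<bar>\<Sum>j<m. f (b j)\<bar> - T / 2)) \<partial>(\<Pi>\<^sub>M j\<in>{..<m}. D))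
    \<le> ennreal (2 * real m * B powr (1 - k))"
proof -
  interpret neg: centred_moment D "\<lambda>x. - f x" k by (rule centred_moment_uminus)
  obtain \<theta> where \<theta>: "\<theta> > 0" "real m * (exp k * \<theta>\<^sup>2 / 2) \<le> \<theta> * T / 8"
    "real m * (exp (\<theta> * B) / B powr k) \<le> 1"
    "2 / \<theta> * exp (1 - \<theta> * T / 4) \<le> real m * B powr (1 - k)"
    using exists_chernoff_parameter[OF k _ B Bk TB Tm] m by auto
  have B0: "B > 0" using B by simp
  have "real m * B powr (1 - k) \<le> B"
  proof -
    have "1 * real m \<le> exp 1 * real m" by (intro mult_right_mono) auto
    then have "real m \<le> B powr k" using Bk by linarith
    then have "real m * B powr (1 - k) \<le> B powr k * B powr (1 - k)" by (intro mult_right_mono) auto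
    then show ?thesis using B0 by (simp flip: powr_add)
  qed
  moreover have "T \<ge> 160 * B"
    using TB tail_const_ge[of k] k B mult_right_mono[of 160 "tail_const k" B] by linarith
  \<comment> \<open>Bias and variance parts of the exponent are thus at most
    \<open>\<theta> T / 8\<close> each and the moment part at most 1, which leaves
    \<open>1 - \<theta> T / 4\<close> out of \<open>- \<theta> T / 2\<close>.\<close>
  ultimately have "8 * (real m * B powr (1 - k)) \<le> T" using B0 by linarith
  then have "\<theta> * (8 * (real m * B powr (1 - k))) \<le> \<theta> * T" using \<theta> by (intro mult_left_mono) auto
  then have "real m * (\<theta> * B powr (1 - k) + exp k * \<theta>\<^sup>2 / 2 + exp (\<theta> * B) / B powr k) - \<theta> * (T / 2)
      \<le> 1 - \<theta> * T / 4"
    using \<theta>(2,3) by (simp add: algebra_simps)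
  then have "1 / \<theta> * exp (real m * (\<theta> * B powr (1 - k) + exp k * \<theta>\<^sup>2 / 2 + exp (\<theta> * B) / B powr k) - \<theta> * (T / 2))
      \<le> 1 / \<theta> * exp (1 - \<theta> * T / 4)"
    using \<theta> by (intro mult_left_mono) auto
  also have "\<dots> \<le> real m * B powr (1 - k) / 2" using \<theta>(4) by (simp add: mult.commute)
  finally have half: "1 / \<theta> * exp (real m * (\<theta> * B powr (1 - k) + exp k * \<theta>\<^sup>2 / 2 + exp (\<theta> * B) / B powr k) - \<theta> * (T / 2))
      \<le> real m * B powr (1 - k) / 2" .
  have pt: "max 0 (\<bar>\<Sum>j<m. f (b j)\<bar> - T / 2) \<le> max 0 ((\<Sum>j<m. trunc B (b j)) - T / 2)
      + max 0 ((\<Sum>j<m. neg.trunc B (b j)) - T / 2) + (\<Sum>j<m. excess B (b j))" for b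
  proof -
    have nt: "(\<Sum>j<m. neg.trunc B (b j)) = - (\<Sum>j<m. trunc B (b j))"
      by (simp add: neg.trunc_def trunc_def if_distrib[of uminus] sum_negf[symmetric] cong: if_cong)
    have "\<bar>(\<Sum>j<m. f (b j)) - (\<Sum>j<m. trunc B (b j))\<bar> \<le> (\<Sum>j<m. excess B (b j))"
      unfolding sum_subtractf[symmetric]
      by (rule order_trans[OF sum_abs]) (auto simp: trunc_def excess_def intro!: sum_mono)
    then show ?thesis unfolding nt by (auto simp: max_def abs_if split: if_splits)
  qed
  have "(\<integral>\<^sup>+b. ennreal (max 0 (\<bar>\<Sum>j<m. f (b j)\<bar> - T / 2)) \<partial>(\<Pi>\<^sub>M j\<in>{..<m}. D))
    \<le> (\<integral>\<^sup>+b. ennreal (max 0 ((\<Sum>j<m. trunc B (b j)) - T / 2))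
      + ennreal (max 0 ((\<Sum>j<m. neg.trunc B (b j)) - T / 2)) + (\<Sum>j<m. ennreal (excess B (b j)))
        \<partial>(\<Pi>\<^sub>M j\<in>{..<m}. D))"
  proof (rule nn_integral_mono)
    fix b
    let ?A = "max 0 ((\<Sum>j<m. trunc B (b j)) - T / 2)" and ?B = "max 0 ((\<Sum>j<m. neg.trunc B (b j)) - T / 2)"
    have "ennreal ?A + ennreal ?B + (\<Sum>j<m. ennreal (excess B (b j))) = ennreal ?A + ennreal ?B + ennreal (\<Sum>j<m. excess B (b j))"
      by (simp add: sum_ennreal excess_nonneg)
    also have "\<dots> = ennreal (?A + ?B + (\<Sum>j<m. excess B (b j)))"
      by (subst ennreal_plus[symmetric]; (subst ennreal_plus[symmetric])?) (auto simp: sum_nonneg excess_nonneg)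
    finally show "ennreal (max 0 (\<bar>\<Sum>j<m. f (b j)\<bar> - T / 2)) \<le> ennreal ?A + ennreal ?B + (\<Sum>j<m. ennreal (excess B (b j)))"
      using ennreal_leI[OF pt] by simp
  qed
  also have "\<dots> = (\<integral>\<^sup>+b. ennreal (max 0 ((\<Sum>j<m. trunc B (b j)) - T / 2)) \<partial>(\<Pi>\<^sub>M j\<in>{..<m}. D))
      + (\<integral>\<^sup>+b. ennreal (max 0 ((\<Sum>j<m. neg.trunc B (b j)) - T / 2)) \<partial>(\<Pi>\<^sub>M j\<in>{..<m}. D))
      + (\<Sum>j<m. \<integral>\<^sup>+b. ennreal (excess B (b j)) \<partial>(\<Pi>\<^sub>M j\<in>{..<m}. D))"
    by (simp add: nn_integral_add nn_integral_sum)
  also have "(\<Sum>j<m. \<integral>\<^sup>+b. ennreal (excess B (b j)) \<partial>(\<Pi>\<^sub>M j\<in>{..<m}. D))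
      = (\<Sum>j<m. ennreal (expectation (excess B)))"
  proof (rule sum.cong[OF refl])
    fix j assume "j \<in> {..<m}"
    then show "(\<integral>\<^sup>+b. ennreal (excess B (b j)) \<partial>(\<Pi>\<^sub>M j\<in>{..<m}. D)) = ennreal (expectation (excess B))"
      using nn_integral_component[of j m "\<lambda>x. ennreal (excess B x)"] integrable_excess[OF B0] excess_nonneg
      by (simp add: nn_integral_eq_integral)
  qed
  also have "\<dots> \<le> (\<Sum>j<m. ennreal (B powr (1 - k)))"
    using expectation_excess_le[OF B0] by (intro sum_mono ennreal_leI)
  also have "\<dots> = ennreal (real m * B powr (1 - k))"
    by (simp add: ennreal_of_nat_eq_real_of_nat ennreal_mult)
  also have "(\<integral>\<^sup>+b. ennreal (max 0 ((\<Sum>j<m. trunc B (b j)) - T / 2)) \<partial>(\<Pi>\<^sub>M j\<in>{..<m}. D))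
      \<le> ennreal (real m * B powr (1 - k) / 2)"
    by (rule order_trans[OF sum_trunc_tail_le[OF B0 \<theta>(1)] ennreal_leI[OF half]])
  also have "(\<integral>\<^sup>+b. ennreal (max 0 ((\<Sum>j<m. neg.trunc B (b j)) - T / 2)) \<partial>(\<Pi>\<^sub>M j\<in>{..<m}. D))
      \<le> ennreal (real m * B powr (1 - k) / 2)"
    by (rule order_trans[OF neg.sum_trunc_tail_le[OF B0 \<theta>(1)] ennreal_leI[OF half]])
  finally show ?thesis by (simp add: add_mono mult.assoc flip: ennreal_plus)
qed

section \<open>Second moments of batch averages\<close>

lemma integral_component:
  fixes g :: "'a \<Rightarrow> real"
  assumes "j < m" "g \<in> borel_measurable D"
  shows "(\<integral>b. g (b j) \<partial>(\<Pi>\<^sub>M j\<in>{..<m}. D)) = expectation g"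
  using integral_distr[of "\<lambda>b. b j" "\<Pi>\<^sub>M j\<in>{..<m}. D" D g] assms by (simp add: distr_component)

lemma integrable_component:
  fixes g :: "'a \<Rightarrow> real"
  assumes "j < m" "integrable D g"
  shows "integrable (\<Pi>\<^sub>M j\<in>{..<m}. D) (\<lambda>b. g (b j))"
  by (rule integrable_distr[of "\<lambda>b. b j" _ D]) (use assms in \<open>auto simp: distr_component\<close>)

lemma cross_moment:
  fixes m :: nat
  assumes "i < m" "j < m" "i \<noteq> j"
  shows "integrable (\<Pi>\<^sub>M j\<in>{..<m}. D) (\<lambda>b. f (b i) * f (b j))"
    and "(\<integral>b. f (b i) * f (b j) \<partial>(\<Pi>\<^sub>M j\<in>{..<m}. D)) = 0"
proof -
  interpret P: product_prob_space "\<lambda>_. D" "{..<m}" by unfold_locales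
  \<comment> \<open>Padding with constants 1 turns the product of two coordinates into a product
    over the whole batch, to which the product integral formula applies.\<close>
  define g where "g l = (if l = i \<or> l = j then f else (\<lambda>_. 1))" for l
  have int: "integrable D (g l)" for l using integrable_f by (simp add: g_def)
  have prod: "(\<Prod>l<m. g l (b l)) = f (b i) * f (b j)" for b
  proof -
    have "(\<Prod>l<m. g l (b l)) = (\<Prod>l\<in>{i, j}. g l (b l))"
      using assms by (intro prod.mono_neutral_right) (auto simp: g_def)
    then show ?thesis using assms by (simp add: g_def)
  qed
  show "integrable (\<Pi>\<^sub>M j\<in>{..<m}. D) (\<lambda>b. f (b i) * f (b j))"
    using P.product_integrable_prod[of "{..<m}" g] int by (simp add: prod)
  have "(\<integral>b. f (b i) * f (b j) \<partial>(\<Pi>\<^sub>M j\<in>{..<m}. D)) = (\<Prod>l<m. expectation (g l))"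
    using P.product_integral_prod[of "{..<m}" g] int by (simp add: prod)
  also have "\<dots> = 0"
    using assms mean by (intro prod_zero) (auto simp: g_def intro!: bexI[of _ i])
  finally show "(\<integral>b. f (b i) * f (b j) \<partial>(\<Pi>\<^sub>M j\<in>{..<m}. D)) = 0" .
qed

definition avg :: "nat \<Rightarrow> (nat \<Rightarrow> 'a) \<Rightarrow> real" where
  "avg m b = (\<Sum>j<m. f (b j)) / real m"

lemma integrable_avg: "integrable (\<Pi>\<^sub>M j\<in>{..<m}. D) (avg m)"
  unfolding avg_def
  by (intro integrable_divide Bochner_Integration.integrable_sum integrable_component integrable_f) auto

lemma integral_avg: "(\<integral>b. avg m b \<partial>(\<Pi>\<^sub>M j\<in>{..<m}. D)) = 0"
proof -
  have "(\<integral>b. (\<Sum>j<m. f (b j)) \<partial>(\<Pi>\<^sub>M j\<in>{..<m}. D)) = (\<Sum>j<m. \<integral>b. f (b j) \<partial>(\<Pi>\<^sub>M j\<in>{..<m}. D))"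
    by (intro Bochner_Integration.integral_sum integrable_component integrable_f) auto
  then show ?thesis using integral_component[OF _ meas, of _ m] mean by (simp add: avg_def)
qed

lemma avg_square: "(avg m b)\<^sup>2 = (\<Sum>i<m. \<Sum>j<m. f (b i) * f (b j)) / (real m)\<^sup>2"
  by (simp add: avg_def power_divide power2_eq_square sum_product)

lemma integrable_product:
  fixes m :: nat
  assumes "i < m" "j < m"
  shows "integrable (\<Pi>\<^sub>M j\<in>{..<m}. D) (\<lambda>b. f (b i) * f (b j))"
  using cross_moment(1)[OF assms] integrable_component[OF _ integrable_square, of j m] assms
  by (cases "i = j") (auto simp: power2_eq_square)

lemma integrable_avg_square: "integrable (\<Pi>\<^sub>M j\<in>{..<m}. D) (\<lambda>b. (avg m b)\<^sup>2)"
  unfolding avg_square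
  by (intro integrable_divide Bochner_Integration.integrable_sum integrable_product) auto

lemma integral_avg_square_le:
  assumes m: "m \<ge> 1"
  shows "(\<integral>b. (avg m b)\<^sup>2 \<partial>(\<Pi>\<^sub>M j\<in>{..<m}. D)) \<le> 1 / real m"
proof -
  let ?P = "\<Pi>\<^sub>M j\<in>{..<m}. D"
  have "(\<integral>b. (\<Sum>i<m. \<Sum>j<m. f (b i) * f (b j)) \<partial>?P) = (\<Sum>i<m. \<Sum>j<m. \<integral>b. f (b i) * f (b j) \<partial>?P)"
    using integrable_product
    by (subst Bochner_Integration.integral_sum; (intro sum.cong refl Bochner_Integration.integral_sum)?) auto
  also have "\<dots> = (\<Sum>i<m. \<Sum>j<m. if j = i then expectation (\<lambda>x. (f x)\<^sup>2) else 0)"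
    using cross_moment(2) integral_component[of _ m "\<lambda>x. (f x)\<^sup>2"]
    by (intro sum.cong refl) (auto simp: power2_eq_square)
  also have "\<dots> = real m * expectation (\<lambda>x. (f x)\<^sup>2)" by simp
  also have "\<dots> \<le> real m" using second_moment_le by (intro mult_left_le) auto
  finally have "(\<integral>b. (\<Sum>i<m. \<Sum>j<m. f (b i) * f (b j)) \<partial>?P) / (real m)\<^sup>2 \<le> real m / (real m)\<^sup>2"
    by (intro divide_right_mono) auto
  then show ?thesis unfolding avg_square using m by (simp add: power2_eq_square)
qed

text \<open>The parabola \<open>z^2 / (2 \<tau>)\<close> dominates the overshoot above
  \<open>\<tau> / 2\<close> and touches it at \<open>\<bar>z\<bar> = \<tau>\<close>, so variance
  \<open>1 / m\<close> alone gives the bound.\<close>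

lemma avg_tail_le_variance:
  assumes m: "m \<ge> 1" and \<tau>: "\<tau> > 0"
  shows "(\<integral>\<^sup>+b. ennreal (max 0 (\<bar>avg m b\<bar> - \<tau> / 2)) \<partial>(\<Pi>\<^sub>M j\<in>{..<m}. D)) \<le> ennreal (1 / (2 * \<tau> * real m))"
proof -
  have pt: "max 0 (\<bar>z\<bar> - \<tau> / 2) \<le> 1 / (2 * \<tau>) * z\<^sup>2" for z :: real
  proof -
    have "0 \<le> (\<bar>z\<bar> - \<tau>)\<^sup>2" by simp
    then have "2 * \<tau> * (\<bar>z\<bar> - \<tau> / 2) \<le> z\<^sup>2" by (simp add: power2_eq_square algebra_simps)
    then show ?thesis using \<tau> by (simp add: field_simps)
  qed
  have "(\<integral>\<^sup>+b. ennreal (max 0 (\<bar>avg m b\<bar> - \<tau> / 2)) \<partial>(\<Pi>\<^sub>M j\<in>{..<m}. D))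
      \<le> (\<integral>\<^sup>+b. ennreal (1 / (2 * \<tau>) * (avg m b)\<^sup>2) \<partial>(\<Pi>\<^sub>M j\<in>{..<m}. D))"
    by (intro nn_integral_mono ennreal_leI pt)
  also have "\<dots> = ennreal (\<integral>b. 1 / (2 * \<tau>) * (avg m b)\<^sup>2 \<partial>(\<Pi>\<^sub>M j\<in>{..<m}. D))"
    using integrable_avg_square \<tau> by (intro nn_integral_eq_integral) auto
  also have "(\<integral>b. 1 / (2 * \<tau>) * (avg m b)\<^sup>2 \<partial>(\<Pi>\<^sub>M j\<in>{..<m}. D))
      = 1 / (2 * \<tau>) * (\<integral>b. (avg m b)\<^sup>2 \<partial>(\<Pi>\<^sub>M j\<in>{..<m}. D))" by (rule integral_mult_right_zero)
  also have "ennreal \<dots> \<le> ennreal (1 / (2 * \<tau>) * (1 / real m))"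
    using integral_avg_square_le[OF m] \<tau> by (intro ennreal_leI mult_left_mono) auto
  finally show ?thesis by simp
qed

lemma avg_tail_le_moment:
  assumes m: "m \<ge> 1" and B: "B \<ge> 1" and Bk: "B powr k \<ge> exp 1 * real m"
    and TB: "T \<ge> tail_const k * B" and Tm: "T \<ge> tail_const k * sqrt (real m * ln (real m))"
  shows "(\<integral>\<^sup>+b. ennreal (max 0 (\<bar>avg m b\<bar> - T / real m / 2)) \<partial>(\<Pi>\<^sub>M j\<in>{..<m}. D))
    \<le> ennreal (2 * B powr (1 - k))"
proof -
  have eq: "max 0 (\<bar>avg m b\<bar> - T / real m / 2) = 1 / real m * max 0 (\<bar>\<Sum>j<m. f (b j)\<bar> - T / 2)" for b
    using m by (simp add: avg_def max_def field_simps)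
  have "(\<integral>\<^sup>+b. ennreal (max 0 (\<bar>avg m b\<bar> - T / real m / 2)) \<partial>(\<Pi>\<^sub>M j\<in>{..<m}. D))
     = ennreal (1 / real m) * (\<integral>\<^sup>+b. ennreal (max 0 (\<bar>\<Sum>j<m. f (b j)\<bar> - T / 2)) \<partial>(\<Pi>\<^sub>M j\<in>{..<m}. D))"
    unfolding eq by (subst ennreal_mult) (auto intro!: nn_integral_cmult)
  also have "\<dots> \<le> ennreal (1 / real m) * ennreal (2 * real m * B powr (1 - k))"
    by (intro mult_left_mono sum_tail_le assms) auto
  also have "\<dots> = ennreal (2 * B powr (1 - k))"
    using m by (simp flip: ennreal_mult)
  finally show ?thesis .
qed

end

text \<open>Only the upper cut at \<open>\<tau> / 2\<close> can lower the mean, and it does so by at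
  most the expected overshoot \<open>b\<close>; the lower cut at \<open>- 3 \<tau> / 2\<close>
  raises the variable and bounds the exponent. Clipping does not increase the absolute value, so the
  second moment bound survives.\<close>

lemma (in prob_space) mgf_skew_clip_le:
  fixes W :: "'a \<Rightarrow> real"
  assumes W: "integrable M W" "expectation W = 0"
    and W2: "integrable M (\<lambda>x. (W x)\<^sup>2)" "expectation (\<lambda>x. (W x)\<^sup>2) \<le> v"
    and tail: "(\<integral>\<^sup>+x. ennreal (max 0 (\<bar>W x\<bar> - \<tau> / 2)) \<partial>M) \<le> ennreal b"
    and b: "b \<ge> 0" and \<tau>: "\<tau> > 0" and l: "l > 0"
  shows "(\<integral>\<^sup>+x. ennreal (exp (- l * skew_clip \<tau> (W x))) \<partial>M)
    \<le> ennreal (exp (l * b + exp (l * (3 * \<tau> / 2)) * l\<^sup>2 / 2 * v))"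
proof -
  have [measurable]: "W \<in> borel_measurable M" using W by auto
  let ?t = "\<lambda>x. max 0 (\<bar>W x\<bar> - \<tau> / 2)"
  let ?c = "exp (l * (3 * \<tau> / 2)) * l\<^sup>2 / 2"
  let ?g = "\<lambda>x. 1 + l * (- W x + ?t x) + ?c * (W x)\<^sup>2"
  have le: "exp (- l * skew_clip \<tau> (W x)) \<le> ?g x" for x
  proof -
    let ?s = "skew_clip \<tau> (W x)"
    have "- ?s \<le> 3 * \<tau> / 2" using \<tau> by (simp add: skew_clip_def)
    then have "l * (- ?s) \<le> l * (3 * \<tau> / 2)" using l by (intro mult_left_mono) auto
    then have "exp (- l * ?s) \<le> 1 + (- l * ?s) + exp (l * (3 * \<tau> / 2)) * (- l * ?s)\<^sup>2 / 2"
      using l \<tau> by (intro exp_le_quadratic) auto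
    also have "\<dots> = 1 + l * (- ?s) + ?c * ?s\<^sup>2" by (simp add: power_mult_distrib)
    also have "\<dots> \<le> ?g x"
    proof (intro add_mono order_refl mult_left_mono)
      show "- ?s \<le> - W x + ?t x" using \<tau> by (auto simp: skew_clip_def max_def min_def)
      have "\<bar>?s\<bar> \<le> \<bar>W x\<bar>" using \<tau> by (auto simp: skew_clip_def max_def min_def)
      then show "?s\<^sup>2 \<le> (W x)\<^sup>2" by (simp add: abs_le_square_iff)
    qed (use l in auto)
    finally show ?thesis .
  qed
  have int_t: "integrable M ?t"
    by (rule Bochner_Integration.integrable_bound[OF W(1)]) (use \<tau> in \<open>auto intro!: AE_I2\<close>)
  have "expectation ?t \<le> b"
  proof -
    have "ennreal (expectation ?t) \<le> ennreal b"
      using tail nn_integral_eq_integral[OF int_t] by (simp add: AE_I2)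
    then show ?thesis using b by (simp add: ennreal_le_iff)
  qed
  have int: "integrable M ?g" using W(1) W2(1) int_t by auto
  have "(\<integral>\<^sup>+x. ennreal (exp (- l * skew_clip \<tau> (W x))) \<partial>M) \<le> (\<integral>\<^sup>+x. ennreal (?g x) \<partial>M)"
    using le by (intro nn_integral_mono ennreal_leI)
  also have "\<dots> = ennreal (expectation ?g)"
    using int le by (intro nn_integral_eq_integral AE_I2) (auto intro: order_trans[OF exp_ge_zero])
  also have "expectation ?g = 1 + l * (- expectation W + expectation ?t) + ?c * expectation (\<lambda>x. (W x)\<^sup>2)"
    using W(1) W2(1) int_t by (simp add: prob_space)
  also have "ennreal \<dots> \<le> ennreal (1 + l * b + ?c * v)"
    using W(2) W2(2) \<open>expectation ?t \<le> b\<close> l by (intro ennreal_leI add_mono mult_left_mono) auto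
  also have "\<dots> \<le> ennreal (exp (l * b + ?c * v))"
  proof (rule ennreal_leI)
    have "1 + a + c \<le> exp (a + c)" for a c :: real
      using exp_ge_add_one_self[of "a + c"] by linarith
    then show "1 + l * b + ?c * v \<le> exp (l * b + ?c * v)" .
  qed
  finally show ?thesis .
qed

lemma (in prob_space) product_lower_tail_le:
  fixes \<phi> :: "'a \<Rightarrow> real"
  assumes [measurable]: "\<phi> \<in> borel_measurable M" and l: "l > 0"
    and mgf: "(\<integral>\<^sup>+x. ennreal (exp (- l * \<phi> x)) \<partial>M) \<le> ennreal (exp c)"
  shows "measure (\<Pi>\<^sub>M i\<in>{..<n}. M) {X \<in> space (\<Pi>\<^sub>M i\<in>{..<n}. M). (\<Sum>i<n. \<phi> (X i)) < - a}
    \<le> exp (real n * c - l * a)"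
proof -
  interpret P: product_prob_space "\<lambda>_. M" "{..<n}" by unfold_locales
  let ?P = "\<Pi>\<^sub>M i\<in>{..<n}. M"
  let ?E = "{X \<in> space ?P. (\<Sum>i<n. \<phi> (X i)) < - a}"
  have "emeasure ?P ?E = (\<integral>\<^sup>+X. indicator ?E X \<partial>?P)" by (subst nn_integral_indicator) auto
  also have "\<dots> \<le> (\<integral>\<^sup>+X. ennreal (exp (- l * a)) * (\<Prod>i<n. ennreal (exp (- l * \<phi> (X i)))) \<partial>?P)"
  proof (rule nn_integral_mono)
    fix X
    have p: "(\<Prod>i<n. ennreal (exp (- l * \<phi> (X i)))) = ennreal (exp (- l * (\<Sum>i<n. \<phi> (X i))))"
      by (simp add: prod_ennreal exp_sum sum_distrib_left flip: sum_negf)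
    have "1 \<le> exp (- l * a) * exp (- l * s)" if "s < - a" for s
    proof -
      have "l * (s + a) \<le> 0" using that l by (intro mult_nonneg_nonpos) auto
      then show ?thesis by (simp flip: exp_add add: algebra_simps)
    qed
    then show "indicator ?E X \<le> ennreal (exp (- l * a)) * (\<Prod>i<n. ennreal (exp (- l * \<phi> (X i))))"
      unfolding p by (auto simp: indicator_def simp flip: ennreal_mult)
  qed
  also have "\<dots> = ennreal (exp (- l * a)) * (\<integral>\<^sup>+X. (\<Prod>i<n. ennreal (exp (- l * \<phi> (X i)))) \<partial>?P)"
    by (intro nn_integral_cmult) measurable
  also have "(\<integral>\<^sup>+X. (\<Prod>i<n. ennreal (exp (- l * \<phi> (X i)))) \<partial>?P) = (\<Prod>i<n. \<integral>\<^sup>+x. ennreal (exp (- l * \<phi> x)) \<partial>M)"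
    by (rule P.product_nn_integral_prod) auto
  also have "\<dots> \<le> (\<Prod>i<n. ennreal (exp c))" using mgf by (intro prod_mono_ennreal) auto
  also have "\<dots> = ennreal (exp (real n * c))" by (simp add: exp_of_nat_mult ennreal_power)
  also have "ennreal (exp (- l * a)) * \<dots> = ennreal (exp (real n * c - l * a))"
    by (simp flip: ennreal_mult exp_add)
  finally show ?thesis by (simp add: P.P.emeasure_eq_measure mult_left_mono)
qed

text \<open>
  Clipping at the first level costs bias \<open>O(\<alpha>)\<close> by the \<open>k\<close>-th moment, at the second by the variance
  alone. The second level keeps the range \<open>O(1 / (m \<alpha>))\<close>, which Bernstein's inequality needs for large
  \<open>\<epsilon>\<close>, where the privacy terms of the sample bound do not control \<open>n\<close>.
\<close>

definition clip_level :: "real \<Rightarrow> nat \<Rightarrow> real \<Rightarrow> real" where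
  "clip_level k m \<alpha> = min (tail_const k * max ((160 / \<alpha>) powr (1 / (k - 1))) (sqrt (real m * ln (real m))) / real m)
     (40 / (real m * \<alpha>))"

text \<open>The smallness of \<alpha> appears here as \<open>m \<alpha>^p \<le> 1/100\<close> with
  \<open>p = k / (k - 1)\<close>. The facts on \<open>B\<close> feed the moment estimate;
  \<open>\<alpha> \<le> \<tau>\<close> lets clipping preserve a displacement of size \<alpha>;
  \<open>m \<alpha> \<tau> \<le> 40\<close> is the range condition for Bernstein's inequality; the
  last bound matches two privacy terms of the sample bound.\<close>

lemma clip_level_bounds:
  fixes k \<alpha> :: real and m :: nat
  assumes k: "k \<ge> 2" and m: "m \<ge> 1" and \<alpha>: "0 < \<alpha>" "\<alpha> \<le> 1"
    and t: "real m * \<alpha> powr (k / (k - 1)) \<le> 1 / 100"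
  defines "B \<equiv> (160 / \<alpha>) powr (1 / (k - 1))" and "\<tau> \<equiv> clip_level k m \<alpha>"
  shows "B \<ge> 1" "B powr k \<ge> exp 1 * real m" "B powr (1 - k) = \<alpha> / 160"
    "\<tau> > 0" "\<alpha> \<le> \<tau>" "real m * \<alpha> * \<tau> \<le> 40"
    "\<tau> / \<alpha> \<le> 160 * tail_const k * (1 / (real m * \<alpha> powr (k / (k - 1))) + sqrt (ln (real m)) / (sqrt (real m) * \<alpha>))"
proof -
  define p where "p = k / (k - 1)"
  define x where "x = \<alpha> powr p"
  define K where "K = tail_const k"
  define S where "S = sqrt (real m * ln (real m))"
  have K: "K \<ge> 160" using tail_const_ge[of k] k by (simp add: K_def)
  have p: "1 \<le> p" "p \<le> 2" and pk: "1 / (k - 1) = p - 1" using k by (auto simp: p_def field_simps)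
  have x: "x > 0" "x \<le> 1 / (100 * real m)" using t \<alpha> m by (auto simp: x_def p_def field_simps)
  have m0: "real m > 0" using m by simp
  \<comment> \<open>Since \<open>1 / (k - 1) = p - 1\<close>, the factor
    \<open>\<alpha> powr (1 - p)\<close> equals \<open>\<alpha> / x\<close>. As
    \<open>1 \<le> p \<le> 2\<close>, the numerical factor lies between 1 and 160, so its dependence
    on \<open>k\<close> disappears.\<close>
  have Beq: "B = 160 powr (p - 1) * (\<alpha> / x)"
    using \<alpha> by (simp add: B_def pk x_def powr_divide powr_diff field_simps)
  have e: "exp 1 \<le> (3::real)" using e_less_272 by simp
  have "160 / \<alpha> \<ge> 1" using \<alpha> by (simp add: field_simps)
  then show B1: "B \<ge> 1" unfolding B_def using k by (intro ge_one_powr_ge_zero) auto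
  show "B powr k \<ge> exp 1 * real m"
  proof -
    have "B powr k = 160 powr p / x"
      using \<alpha> by (simp add: B_def x_def p_def powr_powr powr_divide)
    moreover have "160 powr p \<ge> (160 :: real)" using powr_mono[of 1 p "160::real"] p by simp
    ultimately have "B powr k \<ge> 160 / x" using x by (simp add: divide_right_mono)
    moreover have "160 / x \<ge> 16000 * real m"
      using divide_left_mono[of x "1 / (100 * real m)" 160] x m0 by simp
    moreover have "exp 1 * real m \<le> 3 * real m" using e by (intro mult_right_mono) auto
    ultimately show ?thesis using m0 by linarith
  qed
  have "B powr (1 - k) = (160 / \<alpha>) powr (- 1)"
  proof -
    have "1 / (k - 1) * (1 - k) = - 1" using k by (simp add: field_simps)
    then show ?thesis by (simp add: B_def powr_powr)
  qed
  then show "B powr (1 - k) = \<alpha> / 160" using \<alpha> by (simp add: powr_minus)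
  have \<tau>: "\<tau> = min (K * max B S / real m) (40 / (real m * \<alpha>))"
    by (simp add: \<tau>_def clip_level_def K_def B_def S_def)
  show "\<tau> > 0" unfolding \<tau> using K B1 m0 \<alpha> by (auto simp: max_def)
  have "x * real m \<le> 1 / 100" using x m0 by (simp add: field_simps)
  have B_ge: "B \<ge> \<alpha> * real m"
  proof -
    have "160 powr (p - 1) \<ge> (1 :: real)" using p by (intro ge_one_powr_ge_zero) auto
    then have "B \<ge> 1 * (\<alpha> / x)" unfolding Beq using \<alpha> x by (intro mult_right_mono) auto
    moreover have "\<alpha> / x \<ge> \<alpha> / (1 / (100 * real m))" using x m0 \<alpha> by (intro divide_left_mono) auto
    moreover have "\<alpha> * real m \<ge> 0" using \<alpha> by simp
    ultimately show ?thesis by (simp add: mult.left_commute)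
  qed
  show "\<alpha> \<le> \<tau>"
    unfolding \<tau>
  proof (rule min.boundedI)
    have "1 * B \<le> K * max B S" using K B1 by (intro mult_mono) auto
    then have "\<alpha> * real m \<le> K * max B S" using B_ge by linarith
    then show "\<alpha> \<le> K * max B S / real m" using m0 by (simp add: field_simps)
    have "\<alpha> powr 2 \<le> \<alpha> powr p" using p \<alpha> by (intro powr_mono') auto
    then have "\<alpha>\<^sup>2 \<le> x" using \<alpha> by (simp add: x_def)
    then have "real m * \<alpha>\<^sup>2 \<le> real m * x" by (intro mult_left_mono) auto
    then have "real m * \<alpha>\<^sup>2 \<le> 40" using \<open>x * real m \<le> 1 / 100\<close> by (simp add: mult.commute)
    then show "\<alpha> \<le> 40 / (real m * \<alpha>)" using m0 \<alpha> by (simp add: field_simps power2_eq_square)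
  qed
  have "\<tau> \<le> 40 / (real m * \<alpha>)" unfolding \<tau> by simp
  then have "real m * \<alpha> * \<tau> \<le> real m * \<alpha> * (40 / (real m * \<alpha>))"
    using m0 \<alpha> by (intro mult_left_mono) auto
  then show "real m * \<alpha> * \<tau> \<le> 40" using m0 \<alpha> by simp
  have "160 powr (p - 1) \<le> (160 :: real)" using powr_mono[of "p - 1" 1 "160::real"] p by simp
  then have B_le: "B \<le> 160 * (\<alpha> / x)" unfolding Beq using \<alpha> x by (intro mult_right_mono) auto
  have S0: "S \<ge> 0" using m by (simp add: S_def)
  have "\<tau> \<le> K * max B S / real m" unfolding \<tau> by simp
  also have "\<dots> \<le> K * (B + 160 * S) / real m"
    using K B1 S0 m0 by (intro divide_right_mono mult_left_mono) auto
  also have "\<dots> \<le> K * (160 * (\<alpha> / x) + 160 * S) / real m"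
    using K m0 B_le by (intro divide_right_mono mult_left_mono) auto
  finally have "\<tau> / \<alpha> \<le> K * (160 * (\<alpha> / x) + 160 * S) / real m / \<alpha>"
    using \<alpha> by (intro divide_right_mono) auto
  also have "\<dots> = 160 * K * (1 / (real m * x) + S / real m / \<alpha>)"
    using \<alpha> x m0 by (simp add: field_simps)
  also have "S / real m = sqrt (ln (real m)) / sqrt (real m)"
    using m0 by (simp add: S_def real_sqrt_mult field_simps)
  finally show "\<tau> / \<alpha> \<le> 160 * tail_const k * (1 / (real m * \<alpha> powr (k / (k - 1))) + sqrt (ln (real m)) / (sqrt (real m) * \<alpha>))"
    by (simp add: K_def x_def p_def)
qed

context centred_moment
begin

text \<open>The constants of \<open>clip_level\<close> are calibrated so that both branches give the
  same bias: \<open>2 B^(1-k) = 2 \<alpha> / 160\<close> in one, and \<open>1 / (2 \<tau> m)\<close>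
  at \<open>\<tau> = 40 / (m \<alpha>)\<close> in the other.\<close>

lemma avg_tail_le:
  fixes \<alpha> :: real
  assumes m: "m \<ge> 1" and \<alpha>: "0 < \<alpha>" "\<alpha> \<le> 1" and t: "real m * \<alpha> powr (k / (k - 1)) \<le> 1 / 100"
  shows "(\<integral>\<^sup>+b. ennreal (max 0 (\<bar>avg m b\<bar> - clip_level k m \<alpha> / 2)) \<partial>(\<Pi>\<^sub>M j\<in>{..<m}. D)) \<le> ennreal (\<alpha> / 80)"
proof -
  define B where "B = (160 / \<alpha>) powr (1 / (k - 1))"
  define T where "T = tail_const k * max B (sqrt (real m * ln (real m)))"
  note b = clip_level_bounds[OF k m \<alpha> t, folded B_def]
  have K: "tail_const k > 0" using tail_const_ge[of k] k by linarith
  show ?thesis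
  proof (cases "T / real m \<le> 40 / (real m * \<alpha>)")
    case True
    then have eq: "clip_level k m \<alpha> = T / real m" by (simp add: clip_level_def T_def B_def)
    show ?thesis
      unfolding eq
      using avg_tail_le_moment[OF m b(1,2), of T] K b(3) by (simp add: T_def)
  next
    case False
    then have eq: "clip_level k m \<alpha> = 40 / (real m * \<alpha>)" by (simp add: clip_level_def T_def B_def)
    show ?thesis
      unfolding eq
      using avg_tail_le_variance[OF m, of "40 / (real m * \<alpha>)"] \<alpha> m by simp
  qed
qed

lemma clipped_mean_lower_tail:
  fixes \<alpha> :: real
  assumes m: "m \<ge> 1" and \<alpha>: "0 < \<alpha>" "\<alpha> \<le> 1" and t: "real m * \<alpha> powr (k / (k - 1)) \<le> 1 / 100"
  shows "measure (\<Pi>\<^sub>M i\<in>{..<n}. \<Pi>\<^sub>M j\<in>{..<m}. D)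
      {X \<in> space (\<Pi>\<^sub>M i\<in>{..<n}. \<Pi>\<^sub>M j\<in>{..<m}. D).
        (\<Sum>i<n. skew_clip (clip_level k m \<alpha>) (avg m (X i))) < - (real n * \<alpha> / 20)}
    \<le> exp (- (real n * real m * \<alpha>\<^sup>2 / 5000))"
proof -
  let ?\<tau> = "clip_level k m \<alpha>"
  interpret P: prob_space "\<Pi>\<^sub>M j\<in>{..<m}. D" by (intro prob_space_PiM prob_space_axioms)
  \<comment> \<open>By \<open>m \<alpha> \<tau> \<le> 40\<close> this gives
    \<open>l (3 \<tau> / 2) \<le> 1\<close>, so the exponential factor of the variance term is at
    most e. In units of \<open>m \<alpha>^2\<close> the exponent per person is then 1/4800 (bias) +
    272/720000 (variance) - 1/1200 (threshold), below -1/5000.\<close>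
  define l where "l = real m * \<alpha> / 60"
  define c where "c = l * (\<alpha> / 80) + exp (l * (3 * ?\<tau> / 2)) * l\<^sup>2 / 2 * (1 / real m)"
  note b = clip_level_bounds[OF k m \<alpha> t]
  have l0: "l > 0" using m \<alpha> by (simp add: l_def)
  have [measurable]: "avg m \<in> borel_measurable (\<Pi>\<^sub>M j\<in>{..<m}. D)" using integrable_avg by auto
  have "(\<integral>\<^sup>+x. ennreal (exp (- l * skew_clip ?\<tau> (avg m x))) \<partial>(\<Pi>\<^sub>M j\<in>{..<m}. D)) \<le> ennreal (exp c)"
    unfolding c_def
    by (rule P.mgf_skew_clip_le)
       (use integrable_avg integral_avg integrable_avg_square integral_avg_square_le[OF m]
         avg_tail_le[OF m \<alpha> t] \<alpha> b l0 in auto)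
  from P.product_lower_tail_le[OF _ l0 this, of n "real n * \<alpha> / 20"]
  have "measure (\<Pi>\<^sub>M i\<in>{..<n}. \<Pi>\<^sub>M j\<in>{..<m}. D)
      {X \<in> space (\<Pi>\<^sub>M i\<in>{..<n}. \<Pi>\<^sub>M j\<in>{..<m}. D).
        (\<Sum>i<n. skew_clip ?\<tau> (avg m (X i))) < - (real n * \<alpha> / 20)}
    \<le> exp (real n * c - l * (real n * \<alpha> / 20))" by simp
  also have "real n * c - l * (real n * \<alpha> / 20) \<le> - (real n * real m * \<alpha>\<^sup>2 / 5000)"
  proof -
    have "l * (3 * ?\<tau> / 2) \<le> 1" using b(6) by (simp add: l_def mult.assoc mult.left_commute)
    then have "exp (l * (3 * ?\<tau> / 2)) \<le> exp 1" by simp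
    then have "exp (l * (3 * ?\<tau> / 2)) \<le> 272 / 100" using e_less_272 by linarith
    then have "exp (l * (3 * ?\<tau> / 2)) * (l\<^sup>2 / 2 * (1 / real m)) \<le> 272 / 100 * (l\<^sup>2 / 2 * (1 / real m))"
      by (intro mult_right_mono) auto
    also have "\<dots> = 272 / 720000 * (real m * \<alpha>\<^sup>2)"
      using m by (simp add: l_def power2_eq_square field_simps)
    finally have "c \<le> l * (\<alpha> / 80) + 272 / 720000 * (real m * \<alpha>\<^sup>2)" by (simp add: c_def)
    also have "l * (\<alpha> / 80) = real m * \<alpha>\<^sup>2 / 4800" by (simp add: l_def power2_eq_square)
    finally have "c \<le> real m * \<alpha>\<^sup>2 / 4800 + 272 / 720000 * (real m * \<alpha>\<^sup>2)" .
    moreover have "l * (\<alpha> / 20) = real m * \<alpha>\<^sup>2 / 1200" by (simp add: l_def power2_eq_square)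
    moreover have "0 \<le> real m * \<alpha>\<^sup>2" by simp
    ultimately have "c - l * (\<alpha> / 20) \<le> - (real m * \<alpha>\<^sup>2 / 5000)" by linarith
    then have "real n * (c - l * (\<alpha> / 20)) \<le> real n * - (real m * \<alpha>\<^sup>2 / 5000)"
      by (intro mult_left_mono) auto
    then show ?thesis by (simp add: algebra_simps)
  qed
  finally show ?thesis by simp
qed

end

section \<open>Scores of candidates\<close>

text \<open>
  For a distant candidate the direction \<open>v\<close> of the net closest to \<open>x\<close> witnesses a large score; for a
  close one the hypothesis on \<open>skew_clip\<close> in direction \<open>-v\<close> bounds the score in direction \<open>v\<close>.
\<close>

lemma score_gap:
  fixes p :: "(nat \<Rightarrow> real) \<Rightarrow> nat \<Rightarrow> real" and x y0 :: "nat \<Rightarrow> real"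
  assumes N: "finite N" "N \<noteq> {}" "\<And>v. v \<in> N \<Longrightarrow> L2_set v {..<d} = 1" "\<And>v. v \<in> N \<Longrightarrow> (\<lambda>i. - v i) \<in> N"
      "\<And>u. \<exists>v\<in>N. inner_d d u v \<ge> L2_set u {..<d} / 2"
    and p: "\<And>v i. p (\<lambda>l. - v l) i = - p v i"
    and ev: "\<And>v. v \<in> N \<Longrightarrow> (\<Sum>i<n. skew_clip \<tau> (p v i)) \<ge> - (real n * \<alpha> / 20)"
    and \<alpha>: "0 < \<alpha>" "\<alpha> \<le> \<tau>"
    and far: "L2_set x {..<d} > \<alpha>" and near: "L2_set y0 {..<d} \<le> \<alpha> / 20"
  shows "(MAX v\<in>N. \<Sum>i<n. clip \<tau> (p v i + inner_d d x v)) - (MAX v\<in>N. \<Sum>i<n. clip \<tau> (p v i + inner_d d y0 v))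
     \<ge> 7 / 20 * (real n * min (L2_set x {..<d}) \<tau>)"
proof -
  define r where "r = L2_set x {..<d}"
  have \<tau>: "\<tau> > 0" using \<alpha> by simp
  have "(MAX v\<in>N. \<Sum>i<n. clip \<tau> (p v i + inner_d d y0 v)) \<le> real n * \<alpha> / 10"
  proof (subst Max_le_iff)
    show "\<forall>s\<in>(\<lambda>v. \<Sum>i<n. clip \<tau> (p v i + inner_d d y0 v)) ` N. s \<le> real n * \<alpha> / 10"
    proof safe
      fix v assume v: "v \<in> N"
      have y0v: "\<bar>inner_d d y0 v\<bar> \<le> \<alpha> / 20" using inner_d_le_L2_set[of d y0 v] N(3)[OF v] near by simp
      have "(\<Sum>i<n. clip \<tau> (p v i + inner_d d y0 v)) \<le> (\<Sum>i<n. \<alpha> / 20 - skew_clip \<tau> (p (\<lambda>l. - v l) i))"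
        unfolding p by (intro sum_mono order_trans[OF clip_shift_le[OF \<tau>]]) (use y0v in auto)
      also have "\<dots> = real n * \<alpha> / 20 - (\<Sum>i<n. skew_clip \<tau> (p (\<lambda>l. - v l) i))"
        by (simp add: sum_subtractf)
      also have "\<dots> \<le> real n * \<alpha> / 10" using ev[OF N(4)[OF v]] by linarith
      finally show "(\<Sum>i<n. clip \<tau> (p v i + inner_d d y0 v)) \<le> real n * \<alpha> / 10" .
    qed
  qed (use N in auto)
  moreover have "(MAX v\<in>N. \<Sum>i<n. clip \<tau> (p v i + inner_d d x v)) \<ge> real n * (min r \<tau> / 2 - \<alpha> / 20)"
  proof -
    obtain v where v: "v \<in> N" "inner_d d x v \<ge> r / 2" using N(5)[of x] by (auto simp: r_def)
    let ?s = "inner_d d x v"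
    have s0: "?s \<ge> 0" using v(2) far \<alpha> by (simp add: r_def)
    have "real n * (min r \<tau> / 2 - \<alpha> / 20) \<le> (\<Sum>i<n. min r \<tau> / 2 + skew_clip \<tau> (p v i))"
      using ev[OF v(1)] by (simp add: sum.distrib algebra_simps)
    also have "\<dots> \<le> (\<Sum>i<n. clip \<tau> (p v i + ?s))"
    proof (rule sum_mono)
      fix i
      have "min r \<tau> / 2 \<le> min ?s (\<tau> / 2)" using v(2) by (auto simp: min_def)
      then show "min r \<tau> / 2 + skew_clip \<tau> (p v i) \<le> clip \<tau> (p v i + ?s)"
        using clip_shift_ge[OF \<tau> s0, of "p v i"] by linarith
    qed
    also have "\<dots> \<le> (MAX v\<in>N. \<Sum>i<n. clip \<tau> (p v i + inner_d d x v))"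
      using N(1) v(1) by (intro Max_ge) auto
    finally show ?thesis .
  qed
  \<comment> \<open>Both error terms are now expressed through \<open>min r \<tau>\<close>: 1/2 -
    1/20 - 1/10 = 7/20.\<close>
  moreover have "real n * \<alpha> \<le> real n * min r \<tau>" using far \<alpha> by (intro mult_left_mono) (auto simp: r_def)
  ultimately show ?thesis by (simp add: r_def[symmetric] algebra_simps)
qed

lemma score_sensitivity:
  fixes s s' :: "'v \<Rightarrow> nat \<Rightarrow> real"
  assumes N: "finite N" "N \<noteq> {}" and eq: "\<And>v j. j < n \<Longrightarrow> j \<noteq> i \<Longrightarrow> s v j = s' v j" and i: "i < n"
    and b: "\<And>v j. \<bar>s v j\<bar> \<le> \<tau>" "\<And>v j. \<bar>s' v j\<bar> \<le> \<tau>"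
  shows "(MAX v\<in>N. \<Sum>j<n. s v j) \<le> (MAX v\<in>N. \<Sum>j<n. s' v j) + 2 * \<tau>"
proof (subst Max_le_iff)
  show "\<forall>x\<in>(\<lambda>v. \<Sum>j<n. s v j) ` N. x \<le> (MAX v\<in>N. \<Sum>j<n. s' v j) + 2 * \<tau>"
  proof safe
    fix v assume v: "v \<in> N"
    have "(\<Sum>j<n. s v j) - (\<Sum>j<n. s' v j) = (\<Sum>j<n. s v j - s' v j)" by (simp add: sum_subtractf)
    also have "\<dots> = s v i - s' v i"
      using i eq by (subst sum.remove[of _ i]) (auto intro!: sum.neutral)
    also have "\<dots> \<le> 2 * \<tau>" using b(1)[of v i] b(2)[of v i] by linarith
    finally have "(\<Sum>j<n. s v j) \<le> (\<Sum>j<n. s' v j) + 2 * \<tau>" by simp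
    also have "(\<Sum>j<n. s' v j) \<le> (MAX v\<in>N. \<Sum>j<n. s' v j)" using N v by (intro Max_ge) auto
    finally show "(\<Sum>j<n. s v j) \<le> (MAX v\<in>N. \<Sum>j<n. s' v j) + 2 * \<tau>" by simp
  qed
qed (use N in auto)

section \<open>Candidate grids\<close>

text \<open>One coordinate of the sum over the grid; the bound must not depend on the size of
  \<open>J\<close>, which grows with \<open>R\<close>. It is a two-sided geometric series of ratio
  1/2 around the floor of \<open>x\<close>, and moving the centre there costs the factor
  \<open>exp b\<close>.\<close>

lemma sum_exp_neg_abs_le:
  fixes b x :: real
  assumes b: "b \<ge> ln 2" and J: "finite J"
  shows "(\<Sum>j\<in>J. exp (- b * \<bar>real_of_int j - x\<bar>)) \<le> 3 * exp b"
proof -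
  define j0 where "j0 = \<lfloor>x\<rfloor>"
  have centred: "(\<Sum>j\<in>{j0 - int K..j0 + int K}. (1 / 2 :: real) ^ nat \<bar>j - j0\<bar>) = 3 - 2 * (1 / 2) ^ K" for K
  proof (induction K)
    case (Suc K)
    have "{j0 - int (Suc K)..j0 + int (Suc K)} =
        insert (j0 - int (Suc K)) (insert (j0 + int (Suc K)) {j0 - int K..j0 + int K})" by auto
    then show ?case using Suc by (simp add: nat_add_distrib)
  qed simp
  \<comment> \<open>Any radius covering \<open>J\<close> would do; the sum of all distances is one
    that needs no case for empty \<open>J\<close>.\<close>
  define K where "K = (\<Sum>j\<in>J. nat \<bar>j - j0\<bar>)"
  have "J \<subseteq> {j0 - int K..j0 + int K}"
  proof
    fix j assume "j \<in> J"
    then have "nat \<bar>j - j0\<bar> \<le> K" unfolding K_def using J by (intro member_le_sum) auto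
    then show "j \<in> {j0 - int K..j0 + int K}" by auto
  qed
  then have "(\<Sum>j\<in>J. (1 / 2 :: real) ^ nat \<bar>j - j0\<bar>) \<le> (\<Sum>j\<in>{j0 - int K..j0 + int K}. (1 / 2) ^ nat \<bar>j - j0\<bar>)"
    by (intro sum_mono2) auto
  then have le3: "(\<Sum>j\<in>J. (1 / 2 :: real) ^ nat \<bar>j - j0\<bar>) \<le> 3"
    unfolding centred by (rule order_trans) simp
  have b0: "b > 0" using b ln_gt_zero[of 2] by linarith
  have "exp (- b * \<bar>real_of_int j - x\<bar>) \<le> exp b * (1 / 2) ^ nat \<bar>j - j0\<bar>" for j
  proof -
    have "\<bar>real_of_int j - x\<bar> \<ge> real_of_int \<bar>j - j0\<bar> - 1"
      unfolding j0_def by (simp add: abs_le_iff) linarith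
    then have "b * (real_of_int \<bar>j - j0\<bar> - 1) \<le> b * \<bar>real_of_int j - x\<bar>"
      using b0 by (intro mult_left_mono) auto
    then have "exp (- b * \<bar>real_of_int j - x\<bar>) \<le> exp (b + real (nat \<bar>j - j0\<bar>) * (- b))"
      by (simp add: algebra_simps)
    also have "\<dots> = exp b * exp (- b) ^ nat \<bar>j - j0\<bar>" by (simp only: exp_add exp_of_nat_mult)
    also have "\<dots> \<le> exp b * (1 / 2) ^ nat \<bar>j - j0\<bar>"
    proof -
      have "exp (- b) \<le> exp (- ln 2)" using b by simp
      then have "exp (- b) \<le> 1 / 2" by (simp add: exp_minus)
      then show ?thesis by (intro mult_left_mono power_mono) auto
    qed
    finally show ?thesis .
  qed
  then have "(\<Sum>j\<in>J. exp (- b * \<bar>real_of_int j - x\<bar>)) \<le> (\<Sum>j\<in>J. exp b * (1 / 2) ^ nat \<bar>j - j0\<bar>)"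
    by (rule sum_mono)
  also have "\<dots> \<le> exp b * 3" unfolding sum_distrib_left[symmetric] using le3 by simp
  finally show ?thesis by (simp add: mult.commute)
qed

definition grid :: "nat \<Rightarrow> real \<Rightarrow> int \<Rightarrow> (nat \<Rightarrow> real) set" where
  "grid d h J = (\<Pi>\<^sub>E i\<in>{..<d}. (\<lambda>j. h * real_of_int j) ` {- J..J})"

lemma finite_grid: "finite (grid d h J)"
  unfolding grid_def by (intro finite_PiE) auto

lemma grid_subset: "grid d h J \<subseteq> space (euclid d)"
  unfolding grid_def euclid_def by (auto simp: space_PiM PiE_iff)

lemma card_grid_le:
  assumes J: "J = \<lceil>R / h\<rceil>" and R: "R \<ge> 0" "h > 0"
  shows "real (card (grid d h J)) \<le> (2 * R / h + 3) ^ d"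
proof -
  have "card (grid d h J) \<le> (nat (2 * J + 1)) ^ d"
  proof -
    have "card ((\<lambda>j. h * real_of_int j) ` {- J..J}) \<le> card {- J..J}" by (rule card_image_le) simp
    also have "\<dots> = nat (2 * J + 1)" by simp
    finally show ?thesis unfolding grid_def by (subst card_PiE) (auto intro: power_mono)
  qed
  then have "real (card (grid d h J)) \<le> real (nat (2 * J + 1)) ^ d"
    by (metis of_nat_le_iff of_nat_power)
  also have "\<dots> \<le> (2 * R / h + 3) ^ d"
  proof (rule power_mono)
    have "R / h \<ge> 0" using R by simp
    then have "J \<ge> 0" unfolding J by linarith
    moreover have "real_of_int J \<le> R / h + 1" unfolding J by linarith
    ultimately show "real (nat (2 * J + 1)) \<le> 2 * R / h + 3" by simp
  qed simp
  finally show ?thesis .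
qed

lemma exists_grid_point_near:
  assumes J: "J = \<lceil>R / h\<rceil>" and h: "h > 0" and \<mu>: "\<And>i. i < d \<Longrightarrow> \<mu> i \<in> {-R..R}"
  obtains y where "y \<in> grid d h J" "L2_set (\<lambda>i. y i - \<mu> i) {..<d} \<le> h * sqrt (real d)"
proof -
  define y where "y = (\<lambda>i\<in>{..<d}. h * real_of_int \<lfloor>\<mu> i / h\<rfloor>)"
  have "y \<in> grid d h J"
    unfolding grid_def y_def
  proof (intro restrict_PiE_iff[THEN iffD2] ballI imageI)
    fix i assume "i \<in> {..<d}"
    then have "\<mu> i / h \<le> R / h" "- (R / h) \<le> \<mu> i / h"
      using \<mu>[of i] h by (auto simp: field_simps)
    then show "\<lfloor>\<mu> i / h\<rfloor> \<in> {- J..J}" unfolding J by auto linarith+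
  qed
  moreover have "L2_set (\<lambda>i. y i - \<mu> i) {..<d} \<le> h * sqrt (real d)"
  proof -
    have "\<bar>y i - \<mu> i\<bar> \<le> h" if "i < d" for i
    proof -
      have "y i - \<mu> i = h * (real_of_int \<lfloor>\<mu> i / h\<rfloor> - \<mu> i / h)"
        using that h by (simp add: y_def field_simps)
      moreover have "\<bar>real_of_int \<lfloor>\<mu> i / h\<rfloor> - \<mu> i / h\<bar> \<le> 1" by linarith
      ultimately show ?thesis using h by (simp add: abs_mult mult_left_le)
    qed
    then have "(\<Sum>i<d. (y i - \<mu> i)\<^sup>2) \<le> (\<Sum>i<d. h\<^sup>2)"
      by (intro sum_mono) (metis abs_ge_zero abs_power2 lessThan_iff power2_abs power_mono)
    then have "(\<Sum>i<d. (y i - \<mu> i)\<^sup>2) \<le> h\<^sup>2 * real d" by (simp add: mult.commute)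
    then have "sqrt (\<Sum>i<d. (y i - \<mu> i)\<^sup>2) \<le> sqrt (h\<^sup>2 * real d)" by simp
    then show ?thesis using h by (simp add: L2_set_def real_sqrt_mult)
  qed
  ultimately show ?thesis by (rule that)
qed

lemma L1_le_sqrt_L2: "(\<Sum>i<d. \<bar>u i\<bar>) \<le> sqrt (real d) * L2_set u {..<d}"
  using L2_set_mult_ineq[of "\<lambda>_. 1" u "{..<d}"] by (simp add: L2_set_def)

text \<open>The Euclidean norm is at least the sum norm divided by \<open>sqrt d\<close>, and the
  exponential of the sum norm factorises over the coordinates of the grid. The bound does not
  involve \<open>J\<close>, hence not \<open>R\<close>.\<close>

lemma sum_grid_exp_le:
  assumes d: "d \<ge> 1" and h: "h > 0" and a: "a \<ge> 0" and b: "a * h / sqrt (real d) \<ge> ln 2"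
  shows "(\<Sum>y\<in>grid d h J. exp (- a * L2_set (\<lambda>i. y i - \<mu> i) {..<d})) \<le> 3 ^ d * exp (a * h * sqrt (real d))"
proof -
  define c where "c = a / sqrt (real d)"
  have sd: "sqrt (real d) > 0" using d by simp
  have c0: "c \<ge> 0" using a sd by (simp add: c_def)
  have "exp (- a * L2_set (\<lambda>i. y i - \<mu> i) {..<d}) \<le> (\<Prod>i<d. exp (- c * \<bar>y i - \<mu> i\<bar>))" for y
  proof -
    have "c * (\<Sum>i<d. \<bar>y i - \<mu> i\<bar>) \<le> c * (sqrt (real d) * L2_set (\<lambda>i. y i - \<mu> i) {..<d})"
      by (intro mult_left_mono L1_le_sqrt_L2 c0)
    also have "\<dots> = a * L2_set (\<lambda>i. y i - \<mu> i) {..<d}" using sd by (simp add: c_def)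
    finally show ?thesis by (simp add: exp_sum[symmetric] sum_distrib_left sum_negf)
  qed
  then have "(\<Sum>y\<in>grid d h J. exp (- a * L2_set (\<lambda>i. y i - \<mu> i) {..<d}))
      \<le> (\<Sum>y\<in>grid d h J. \<Prod>i<d. exp (- c * \<bar>y i - \<mu> i\<bar>))" by (rule sum_mono)
  also have "\<dots> = (\<Prod>i<d. \<Sum>z\<in>(\<lambda>j. h * real_of_int j) ` {- J..J}. exp (- c * \<bar>z - \<mu> i\<bar>))"
    unfolding grid_def by (rule prod_sum_PiE[symmetric]) auto
  also have "\<dots> \<le> (\<Prod>i<d. 3 * exp (c * h))"
  proof (rule prod_mono, intro conjI)
    fix i
    have "(\<Sum>z\<in>(\<lambda>j. h * real_of_int j) ` {- J..J}. exp (- c * \<bar>z - \<mu> i\<bar>))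
        = (\<Sum>j\<in>{- J..J}. exp (- c * \<bar>h * real_of_int j - \<mu> i\<bar>))"
      using h by (subst sum.reindex) (auto simp: inj_on_def)
    also have "\<dots> = (\<Sum>j\<in>{- J..J}. exp (- (c * h) * \<bar>real_of_int j - \<mu> i / h\<bar>))"
    proof (rule sum.cong[OF refl])
      fix j
      have "h * real_of_int j - \<mu> i = h * (real_of_int j - \<mu> i / h)" using h by (simp add: field_simps)
      then show "exp (- c * \<bar>h * real_of_int j - \<mu> i\<bar>) = exp (- (c * h) * \<bar>real_of_int j - \<mu> i / h\<bar>)"
        using h by (simp add: abs_mult)
    qed
    also have "\<dots> \<le> 3 * exp (c * h)"
      using b by (intro sum_exp_neg_abs_le) (auto simp: c_def)
    finally show "(\<Sum>z\<in>(\<lambda>j. h * real_of_int j) ` {- J..J}. exp (- c * \<bar>z - \<mu> i\<bar>)) \<le> 3 * exp (c * h)" .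
  qed (simp add: sum_nonneg)
  also have "\<dots> = 3 ^ d * exp (real d * (c * h))" by (simp add: power_mult_distrib exp_of_nat_mult)
  also have "real d * (c * h) = a * h * sqrt (real d)"
    using real_sqrt_mult_self[of "real d"] sd by (simp add: c_def field_simps)
  finally show ?thesis .
qed

section \<open>The sample size\<close>

text \<open>The first two facts are auxiliary; the other three serve the union bound over the net,
  the candidates within the clipping level, and the more distant ones. The hypothesis on
  \<open>R\<close> controls the logarithm in the last term of the sample bound from below.\<close>

lemma sample_size_consequences:
  fixes k R \<epsilon> \<alpha> \<beta> :: real and d m n :: nat
  assumes k: "k \<ge> 2" and d: "d \<ge> 1" and m: "m \<ge> 1" and \<epsilon>: "\<epsilon> > 0" and \<alpha>: "0 < \<alpha>" "\<alpha> \<le> 1"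
    and t: "real m * \<alpha> powr (k / (k - 1)) \<le> 1 / 100" and \<beta>: "0 < \<beta>" "\<beta> < 1"
    and R: "\<alpha> < R * sqrt (real d)"
    and n: "real n \<ge> 200000 * tail_const k * sample_bound k d m R \<epsilon> \<alpha> \<beta>"
  defines "l \<equiv> ln (max 2 (real d) / \<beta>)"
  shows "l \<ge> ln 2" "ln (4 / \<beta>) \<le> 3 * real d * l"
    "2 * (9 * real d) ^ d * exp (- (real n * real m * \<alpha>\<^sup>2 / 5000)) \<le> \<beta> / 2"
    "\<epsilon> * real n * \<alpha> / (12 * clip_level k m \<alpha>) \<ge> 40 * real d * l"
    "(2 * R / (\<alpha> / (20 * sqrt (real d))) + 3) ^ d * exp (- (\<epsilon> * real n / 12)) \<le> \<beta> / 4"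
proof -
  define K where "K = tail_const k"
  define l0 where "l0 = ln (max 2 (real d))"
  define p where "p = k / (k - 1)"
  define x where "x = real m * \<alpha> powr p"
  define Lr where "Lr = ln (real d * R * real m / \<beta>)"
  define Y where "Y = sqrt (ln (real m)) / (sqrt (real m) * \<alpha>)"
  define S where "S = sample_bound k d m R \<epsilon> \<alpha> \<beta>"
  have K: "K \<ge> 160" using tail_const_ge[of k] k by (simp add: K_def)
  have p: "1 \<le> p" using k by (auto simp: p_def field_simps)
  have x: "0 < x" "x \<le> 1 / 100" using t m \<alpha> by (auto simp: x_def p_def)
  have d1: "real d \<ge> 1" and m1: "real m \<ge> 1" using d m by auto
  have ln2: "ln 2 \<ge> (2 / 3 :: real)" by (rule ln2_ge_two_thirds)
  have l0: "l0 \<ge> ln 2" unfolding l0_def by (intro ln_mono) auto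
  have lb: "ln (1 / \<beta>) > 0" using \<beta> by (simp add: ln_div)
  have l_eq: "l = l0 + ln (1 / \<beta>)" using \<beta> by (simp add: l_def l0_def ln_div)
  show l: "l \<ge> ln 2" using l_eq lb l0 by linarith
  have Y0: "Y \<ge> 0" using m1 \<alpha> by (simp add: Y_def)
  have dl: "real d * l \<ge> l" "real d * l0 \<ge> l0"
    using mult_right_mono[OF d1, of l] mult_right_mono[OF d1, of l0] l l0 ln2 by auto
  have ln4: "ln 4 = 2 * ln (2::real)" using ln_realpow[of 2 2] by simp
  show l4: "ln (4 / \<beta>) \<le> 3 * real d * l"
  proof -
    have "ln (4 / \<beta>) = ln 4 + ln (1 / \<beta>)" using \<beta> by (simp add: ln_div)
    then show ?thesis using ln4 dl(1) l l_eq l0 ln2 lb by linarith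
  qed
  have lnx: "ln (1 / x) \<le> l / (2 * x)"
  proof -
    define u where "u = 1 / x"
    have u: "u \<ge> 100" using x by (simp add: u_def field_simps)
    have su: "sqrt u \<ge> 10" using u real_le_rsqrt[of 10 u] by simp
    have "ln u = 2 * ln (sqrt u)" using u by (simp add: ln_sqrt)
    also have "\<dots> \<le> 2 * sqrt u" using ln_le_minus_one[of "sqrt u"] u by simp
    also have "\<dots> \<le> u / 5"
      using mult_right_mono[OF su, of "sqrt u"] u by simp
    also have "\<dots> \<le> u / 2 * (2 / 3)" using u by simp
    also have "\<dots> \<le> u / 2 * l" using l ln2 u by (intro mult_left_mono) auto
    finally show ?thesis by (simp add: u_def)
  qed
  have sd: "1 \<le> sqrt (real d)" "sqrt (real d) \<le> real d"
    using d1 real_le_lsqrt[of "real d" "real d"] by (auto simp: power2_eq_square)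
  have R0: "R > 0" using R \<alpha> sd by (smt (verit) mult_nonpos_nonneg)
  have \<alpha>p: "\<alpha> powr p \<le> \<alpha>" using powr_mono'[of 1 p \<alpha>] p \<alpha> by simp
  have Rd: "R * sqrt (real d) \<le> real d * R" using sd R0 by simp
  \<comment> \<open>From \<open>d R \<ge> R sqrt d > \<alpha> \<ge> \<alpha>^p\<close>, the argument
    of the logarithm is at least \<open>x\<close>. Hence a negative \<open>Lr\<close> costs at most
    half of the term \<open>Z\<close> below.\<close>
  have Lr_ge: "Lr \<ge> - (l / (2 * x))"
  proof -
    have "x \<le> real m * \<alpha>" unfolding x_def using \<alpha>p by (intro mult_left_mono) auto
    also have "\<dots> \<le> real m * (real d * R)" using R Rd by (intro mult_left_mono) auto
    also have "\<dots> \<le> real m * (real d * R) / \<beta>"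
      using \<beta> R0 by (simp add: le_divide_eq mult_left_le)
    finally have "ln x \<le> Lr" unfolding Lr_def using x by (intro ln_mono) (auto simp: ac_simps)
    then show ?thesis using lnx x by (simp add: ln_div)
  qed
  define T1 where "T1 = real d * l0 / (real m * \<alpha>\<^sup>2 * \<beta>)"
  define Z where "Z = real d * l / x"
  have S: "S = T1 + (real d * l * Y + Z + real d * Lr) / \<epsilon>"
    unfolding S_def sample_bound_def T1_def l_def[symmetric] l0_def[symmetric] Lr_def[symmetric] p_def[symmetric] x_def[symmetric]
    by (simp add: Y_def Z_def add_divide_distrib mult.assoc)
  have T1: "T1 \<ge> 0" using l0 ln2 \<beta> by (simp add: T1_def)
  have dLr: "real d * Lr \<ge> - (Z / 2)"
    using mult_left_mono[OF Lr_ge, of "real d"] by (simp add: Z_def)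
  have dlx0: "Z \<ge> 0" and dlY0: "real d * l * Y \<ge> 0"
    using l ln2 x Y0 by (auto simp: Z_def)
  have ST1: "S \<ge> T1"
  proof -
    have "real d * l * Y + Z + real d * Lr \<ge> 0" using dLr dlx0 dlY0 by linarith
    then show ?thesis unfolding S using \<epsilon> by simp
  qed
  have "\<epsilon> * S = \<epsilon> * T1 + (real d * l * Y + Z + real d * Lr)"
    unfolding S using \<epsilon> by (simp add: distrib_left[of \<epsilon> T1])
  moreover have "\<epsilon> * T1 \<ge> 0" using T1 \<epsilon> by simp
  ultimately have \<epsilon>S: "\<epsilon> * S \<ge> real d * l * Y + Z + real d * Lr" by linarith
  have n': "real n \<ge> 200000 * K * S" using n by (simp add: K_def S_def)
  have S0: "S \<ge> 0" using ST1 T1 by linarith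
  have \<epsilon>S0: "\<epsilon> * S \<ge> 0" using S0 \<epsilon> by simp
  show "2 * (9 * real d) ^ d * exp (- (real n * real m * \<alpha>\<^sup>2 / 5000)) \<le> \<beta> / 2"
  proof -
    \<comment> \<open>The factor \<open>1 / \<beta>\<close> also pays for the union bound's
      \<open>ln (1 / \<beta>)\<close>. The logarithms to be beaten add up to at most 9
      \<open>z\<close>, while 200000 / 5000 = 40 times \<open>z\<close> is available.\<close>
    define z where "z = real d * l0 / \<beta>"
    have z: "real d * l0 \<le> z" using \<beta> l0 ln2 by (simp add: z_def le_divide_eq mult_left_le)
    have "200000 * 1 * T1 \<le> 200000 * K * S" using K ST1 T1 by (intro mult_mono) auto
    then have "200000 * T1 \<le> real n" using n' by linarith
    then have "200000 * T1 * (real m * \<alpha>\<^sup>2) \<le> real n * (real m * \<alpha>\<^sup>2)"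
      by (intro mult_right_mono) auto
    moreover have "T1 * (real m * \<alpha>\<^sup>2) = z" using m1 \<alpha> by (simp add: T1_def z_def)
    ultimately have nz: "real n * real m * \<alpha>\<^sup>2 / 5000 \<ge> 40 * z" by (simp add: mult.assoc)
    have "ln 9 \<le> ln (2 ^ 4 :: real)" by (intro ln_mono) auto
    then have "ln 9 \<le> 4 * ln (2::real)" by (subst (asm) ln_realpow) auto
    moreover have "ln (real d) \<le> l0" unfolding l0_def using d1 by (intro ln_mono) auto
    moreover have "ln (9 * real d) = ln 9 + ln (real d)" using d d1 by (simp add: ln_mult)
    ultimately have "ln (9 * real d) \<le> 5 * l0" using l0 by linarith
    then have "real d * ln (9 * real d) \<le> 5 * z"
      using mult_left_mono[of "ln (9 * real d)" "5 * l0" "real d"] z by simp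
    moreover have "ln 2 \<le> z" using z dl l0 by linarith
    moreover have "ln (1 / \<beta>) \<le> 2 * z"
    proof -
      have "ln (1 / \<beta>) \<le> 1 / \<beta>" using ln_le_minus_one[of "1 / \<beta>"] \<beta> by simp
      also have "\<dots> \<le> 2 * (real d * l0) / \<beta>" using dl l0 ln2 \<beta> by (intro divide_right_mono) linarith+
      finally show ?thesis by (simp add: z_def)
    qed
    moreover have "ln (\<beta> / 2) = - ln (1 / \<beta>) - ln 2" using \<beta> by (simp add: ln_div)
    moreover have "z \<ge> 0" using z l0 ln2 dl by linarith
    ultimately have "ln 2 + real d * ln (9 * real d) - real n * real m * \<alpha>\<^sup>2 / 5000 \<le> ln (\<beta> / 2)"
      using nz by linarith
    then have "exp (ln 2 + real d * ln (9 * real d) - real n * real m * \<alpha>\<^sup>2 / 5000) \<le> exp (ln (\<beta> / 2))" by simp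
    moreover have "exp (ln 2 + real d * ln (9 * real d) - real n * real m * \<alpha>\<^sup>2 / 5000)
        = 2 * (9 * real d) ^ d * exp (- (real n * real m * \<alpha>\<^sup>2 / 5000))"
    proof -
      have "exp (ln 2 + real d * ln (9 * real d) - u) = 2 * (9 * real d) ^ d * exp (- u)" for u
        using d1 by (simp add: exp_add exp_of_nat_mult diff_conv_add_uminus del: add_uminus_conv_diff)
      then show ?thesis .
    qed
    ultimately show ?thesis using \<beta> by simp
  qed
  show "\<epsilon> * real n * \<alpha> / (12 * clip_level k m \<alpha>) \<ge> 40 * real d * l"
  proof -
    note b = clip_level_bounds[OF k m \<alpha> t]
    let ?\<tau> = "clip_level k m \<alpha>"
    have tau: "?\<tau> / \<alpha> \<le> 160 * K * (1 / x + Y)" using b(7) by (simp add: K_def x_def p_def Y_def)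
    have "real d * l * (1 / x + Y) \<le> 2 * (\<epsilon> * S)"
    proof -
      have "real d * l * (1 / x + Y) = Z + real d * l * Y" by (simp add: Z_def distrib_left)
      also have "\<dots> \<le> 2 * (\<epsilon> * S)" using \<epsilon>S dLr dlY0 dlx0 by linarith
      finally show ?thesis .
    qed
    \<comment> \<open>Here 480 = 12 * 40. The total factor is 480 * 160 * 2 = 153600, where 2
      compensates for a negative \<open>Lr\<close>; this accounts for most of the constant
      200000.\<close>
    have "480 * (real d * l) * (?\<tau> / \<alpha>) \<le> 480 * (real d * l) * (160 * K * (1 / x + Y))"
      using tau l ln2 by (intro mult_left_mono) auto
    also have "\<dots> = 76800 * K * (real d * l * (1 / x + Y))" by simp
    also have "\<dots> \<le> 76800 * K * (2 * (\<epsilon> * S))"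
      using K \<open>real d * l * (1 / x + Y) \<le> 2 * (\<epsilon> * S)\<close> by (intro mult_left_mono) auto
    also have "\<dots> \<le> \<epsilon> * (200000 * K * S)" using K \<epsilon>S0 by (simp add: mult.commute)
    also have "\<dots> \<le> \<epsilon> * real n" using n' \<epsilon> by (intro mult_left_mono) auto
    finally have "480 * (real d * l) * (?\<tau> / \<alpha>) \<le> \<epsilon> * real n" .
    then show ?thesis using b(4) \<alpha> by (simp add: field_simps)
  qed
  show "(2 * R / (\<alpha> / (20 * sqrt (real d))) + 3) ^ d * exp (- (\<epsilon> * real n / 12)) \<le> \<beta> / 4"
  proof -
    \<comment> \<open>Bounds the number of grid points per coordinate. It involves
      \<open>1 / \<alpha>\<close>, whereas \<open>Lr\<close> does not; replacing \<alpha> by the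
      smaller \<open>\<alpha>^p = x / m\<close> leaves an extra \<open>ln (1 / x)\<close>, absorbed
      by \<open>Z\<close>.\<close>
    define w where "w = 2 * R / (\<alpha> / (20 * sqrt (real d))) + 3"
    have w0: "w > 0" using R0 \<alpha> by (simp add: w_def add_nonneg_pos)
    have "w = (40 * (R * sqrt (real d)) + 3 * \<alpha>) / \<alpha>" using \<alpha> by (simp add: w_def field_simps)
    also have "\<dots> \<le> 43 * (real d * R) / \<alpha>" using R Rd \<alpha> by (intro divide_right_mono) linarith+
    also have "\<dots> \<le> 43 * (real d * R) / \<alpha> powr p"
      using \<alpha>p \<alpha> R0 by (intro divide_left_mono) auto
    also have "\<dots> = 43 * (real d * R * real m) * (1 / x)" using m1 by (simp add: x_def)
    also have "\<dots> \<le> 64 * (real d * R * real m / \<beta>) * (1 / x)"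
    proof (intro mult_right_mono)
      have "real d * R * real m \<le> real d * R * real m / \<beta>"
        using \<beta> R0 by (simp add: le_divide_eq mult_left_le)
      moreover have "real d * R * real m \<ge> 0" using R0 by simp
      ultimately show "43 * (real d * R * real m) \<le> 64 * (real d * R * real m / \<beta>)" by linarith
    qed (use x in auto)
    finally have "ln w \<le> ln (64 * (real d * R * real m / \<beta>) * (1 / x))" using w0 by (intro ln_mono) auto
    also have "\<dots> = ln 64 + Lr + ln (1 / x)"
      using R0 d1 m1 \<beta> x by (simp add: Lr_def ln_mult ln_div)
    also have "ln 64 = 6 * ln (2::real)" using ln_realpow[of 2 6] by simp
    also have "6 * ln 2 \<le> 6 * l" using l by simp
    finally have lw: "ln w \<le> 6 * l + Lr + l / (2 * x)" using lnx by linarith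
    have lx: "l \<le> l / x" using x l ln2 by (simp add: le_divide_eq mult_left_le)
    have "ln w \<le> 7 * (l / x) + Lr"
    proof -
      define V where "V = l / x"
      have "ln w \<le> 6 * l + Lr + V / 2" using lw by (simp add: V_def)
      moreover have "l \<le> V" using lx by (simp add: V_def)
      ultimately show ?thesis unfolding V_def[symmetric] using l ln2 by linarith
    qed
    then have "real d * ln w \<le> real d * (7 * (l / x) + Lr)" by (intro mult_left_mono) auto
    then have 1: "real d * ln w \<le> 7 * Z + real d * Lr" by (simp add: Z_def distrib_left mult.left_commute)
    have "real d * l \<le> Z" using mult_left_mono[OF lx, of "real d"] by (simp add: Z_def)
    then have 2: "ln (4 / \<beta>) \<le> 3 * Z" using l4 by linarith
    \<comment> \<open>The requirement is \<open>10 Z + d Lr\<close>. With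
      \<open>d Lr \<ge> - Z / 2\<close>, 19 is the factor for which \<open>19 (Z + d Lr)\<close>
      still dominates it: the difference is \<open>9 Z + 18 d Lr\<close>.\<close>
    have "19 * (\<epsilon> * S) \<le> (200000 * K / 12) * (\<epsilon> * S)" using K \<epsilon>S0 by (intro mult_right_mono) auto
    also have "\<dots> = \<epsilon> * (200000 * K * S) / 12" by simp
    also have "\<dots> \<le> \<epsilon> * real n / 12" using n' \<epsilon> by (intro divide_right_mono mult_left_mono) auto
    finally have 3: "19 * (\<epsilon> * S) \<le> \<epsilon> * real n / 12" .
    have "real d * ln w + ln (4 / \<beta>) \<le> \<epsilon> * real n / 12"
      using 1 2 3 \<epsilon>S dLr dlY0 dlx0 by linarith
    then have "exp (real d * ln w - \<epsilon> * real n / 12) \<le> exp (- ln (4 / \<beta>))" by simp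
    moreover have "exp (- ln (4 / \<beta>)) = \<beta> / 4" using \<beta> by (simp add: exp_minus)
    moreover have "exp (real d * ln w - \<epsilon> * real n / 12) = w ^ d * exp (- (\<epsilon> * real n / 12))"
    proof -
      have "exp (real d * ln w - u) = w ^ d * exp (- u)" for u
        using w0 by (simp add: exp_add exp_of_nat_mult diff_conv_add_uminus del: add_uminus_conv_diff)
      then show ?thesis .
    qed
    ultimately show ?thesis by (simp add: w_def)
  qed
qed

section \<open>The mechanism\<close>

definition proj :: "nat \<Rightarrow> nat \<Rightarrow> (nat \<Rightarrow> real) \<Rightarrow> (nat \<Rightarrow> nat \<Rightarrow> real) \<Rightarrow> real" where
  "proj d m v b = (\<Sum>j<m. inner_d d (b j) v) / real m"

definition score ::
    "(nat \<Rightarrow> real) set \<Rightarrow> nat \<Rightarrow> nat \<Rightarrow> nat \<Rightarrow> real \<Rightarrow> (nat \<Rightarrow> real) \<Rightarrow> (nat \<Rightarrow> nat \<Rightarrow> nat \<Rightarrow> real) \<Rightarrow> real"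
  where "score N d m n \<tau> y X = (MAX v\<in>N. \<Sum>i<n. clip \<tau> (proj d m v (X i) - inner_d d y v))"

lemma score_measurable:
  assumes N: "finite N" "N \<noteq> {}"
  shows "score N d m n \<tau> y \<in> borel_measurable (datasets n m d)"
proof -
  have c: "(\<lambda>X. X i j l) \<in> borel_measurable (datasets n m d)" if "i < n" "j < m" "l < d" for i j l
  proof -
    have 1: "(\<lambda>X. X i) \<in> datasets n m d \<rightarrow>\<^sub>M (\<Pi>\<^sub>M j\<in>{..<m}. euclid d)"
      unfolding datasets_def using that by (intro measurable_component_singleton) auto
    have 2: "(\<lambda>b. b j) \<in> (\<Pi>\<^sub>M j\<in>{..<m}. euclid d) \<rightarrow>\<^sub>M euclid d"
      using that by (intro measurable_component_singleton) auto
    have 3: "(\<lambda>x. x l) \<in> euclid d \<rightarrow>\<^sub>M borel"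
      unfolding euclid_def using that by (intro measurable_component_singleton) auto
    show ?thesis using measurable_compose[OF measurable_compose[OF 1 2] 3] .
  qed
  have "(\<lambda>X. \<Sum>i<n. clip \<tau> (proj d m v (X i) - inner_d d y v)) \<in> borel_measurable (datasets n m d)" for v
    unfolding proj_def inner_d_def
    by (intro borel_measurable_sum measurable_compose[OF _ clip_measurable] borel_measurable_diff
        borel_measurable_divide borel_measurable_times borel_measurable_const c) auto
  then show ?thesis unfolding score_def[abs_def] using N by (intro borel_measurable_Max) auto
qed

lemma score_neighbours:
  assumes N: "finite N" "N \<noteq> {}" and \<tau>: "\<tau> > 0" and nb: "person_neighbours n X X'"
  shows "score N d m n \<tau> y X \<le> score N d m n \<tau> y X' + 2 * \<tau>"
proof -
  obtain i where "i < n" "\<And>j. j < n \<Longrightarrow> j \<noteq> i \<Longrightarrow> X j = X' j"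
    using nb by (auto simp: person_neighbours_def)
  then show ?thesis
    unfolding score_def
    by (intro score_sensitivity[where i = i] N abs_clip_le[OF \<tau>]) auto
qed

lemma person_neighbours_sym: "person_neighbours n X X' \<Longrightarrow> person_neighbours n X' X"
  by (fastforce simp: person_neighbours_def)

lemma accurate_set_measurable:
  "{y \<in> space (euclid d). L2_set (\<lambda>i. y i - \<mu> i) {..<d} \<le> \<alpha>} \<in> sets (euclid d)"
  unfolding euclid_def L2_set_def by measurable

lemma iid_batches_props:
  assumes "distribution_on d D"
  shows "prob_space (iid_batches n m D)" "sets (iid_batches n m D) = sets (datasets n m d)"
proof -
  interpret D: prob_space D using assms by (simp add: distribution_on_def)
  show "prob_space (iid_batches n m D)"
    unfolding iid_batches_def by (intro prob_space_PiM D.prob_space_axioms)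
  show "sets (iid_batches n m D) = sets (datasets n m d)"
    unfolding iid_batches_def datasets_def
    using assms by (intro sets_PiM_cong refl) (simp add: distribution_on_def)
qed

text \<open>Covers the regime where the sample bound may be negative and say nothing about
  \<open>n\<close>: for \<open>\<beta> \<ge> 1\<close> there is nothing to prove about accuracy, and
  for \<open>R sqrt d \<le> \<alpha>\<close> the origin is within \<alpha> of every admissible
  mean.\<close>

lemma constant_mechanism:
  fixes d m n :: nat and \<epsilon> \<alpha> \<beta> R :: real
  assumes \<epsilon>: "\<epsilon> > 0" and \<beta>: "\<beta> > 0" and triv: "\<beta> \<ge> 1 \<or> R * sqrt (real d) \<le> \<alpha>"
  shows "\<exists>A. mechanism n m d A \<and> person_level_dp n m d \<epsilon> A \<and>
        (\<forall>D \<mu>. distribution_on d D \<longrightarrow> has_mean d D \<mu> \<longrightarrow>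
           (\<forall>i<d. \<mu> i \<in> {-R..R}) \<longrightarrow> moment_le_1 d k D \<mu> \<longrightarrow>
           measure (output_distr n m D A)
             {y \<in> space (euclid d). L2_set (\<lambda>i. y i - \<mu> i) {..<d} \<le> \<alpha>} \<ge> 1 - \<beta>)"
proof -
  define z :: "nat \<Rightarrow> real" where "z = (\<lambda>i\<in>{..<d}. 0)"
  have z: "{z} \<subseteq> space (euclid d)" by (auto simp: z_def euclid_def space_PiM)
  define A :: "(nat \<Rightarrow> nat \<Rightarrow> nat \<Rightarrow> real) \<Rightarrow> (nat \<Rightarrow> real) measure"
    where "A = finite_mechanism (euclid d) {z} (\<lambda>_ _. 1)"
  have A: "A \<in> datasets n m d \<rightarrow>\<^sub>M prob_algebra (euclid d)"
    unfolding A_def using z by (intro measurable_finite_mechanism) auto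
  have meas: "measure (A X) Y = (if z \<in> Y then 1 else 0)" if "Y \<in> sets (euclid d)" for X Y
    unfolding A_def using z that by (subst measure_finite_mechanism) auto
  show ?thesis
  proof (intro exI[of _ A] conjI allI impI)
    show "mechanism n m d A" using A by (simp add: mechanism_def)
    show "person_level_dp n m d \<epsilon> A" using \<epsilon> by (auto simp: person_level_dp_def meas)
  next
    fix D \<mu>
    assume D: "distribution_on d D" and \<mu>: "\<forall>i<d. \<mu> i \<in> {-R..R}"
    let ?G = "{y \<in> space (euclid d). L2_set (\<lambda>i. y i - \<mu> i) {..<d} \<le> \<alpha>}"
    show "measure (output_distr n m D A) ?G \<ge> 1 - \<beta>"
    proof (cases "\<beta> \<ge> 1")
      case True
      then show ?thesis using measure_nonneg[of "output_distr n m D A" ?G] by linarith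
    next
      case False
      then have le: "R * sqrt (real d) \<le> \<alpha>" using triv by simp
      note P = iid_batches_props[OF D, of n m]
      have A': "A \<in> iid_batches n m D \<rightarrow>\<^sub>M prob_algebra (euclid d)"
        using A measurable_cong_sets[OF P(2) refl] by blast
      have "L2_set (\<lambda>i. z i - \<mu> i) {..<d} \<le> R * sqrt (real d)"
      proof (cases "d = 0")
        case False
        then have R: "R \<ge> 0" using \<mu>[rule_format, of 0] by auto
        have "(\<Sum>i<d. (z i - \<mu> i)\<^sup>2) \<le> (\<Sum>i<d. R\<^sup>2)"
          using \<mu> by (intro sum_mono) (auto simp: z_def abs_le_square_iff[symmetric] abs_le_iff)
        then have "(\<Sum>i<d. (z i - \<mu> i)\<^sup>2) \<le> R\<^sup>2 * real d" by (simp add: mult.commute)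
        then have "sqrt (\<Sum>i<d. (z i - \<mu> i)\<^sup>2) \<le> sqrt (R\<^sup>2 * real d)" by simp
        then show ?thesis using R by (simp add: L2_set_def real_sqrt_mult)
      qed simp
      then have zG: "z \<in> ?G" using le z by auto
      have "measure (iid_batches n m D \<bind> A) ?G \<ge> 1 - (0 + 0)"
      proof (rule measure_bind_ge[OF A' P(1) accurate_set_measurable, of "{}"])
        have "space (euclid d) - ?G \<in> sets (euclid d)"
          by (intro sets.compl_sets accurate_set_measurable)
        then show "measure (A X) (space (euclid d) - ?G) \<le> 0" for X
          using zG by (simp add: meas)
      qed auto
      then show ?thesis using \<beta> by (simp add: output_distr_def)
    qed
  qed
qed

lemma centred_moment_projection:
  assumes D: "distribution_on d D" and mean: "has_mean d D \<mu>" and mom: "moment_le_1 d k D \<mu>"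
    and k: "k \<ge> 2" and v: "L2_set v {..<d} = 1"
  shows "centred_moment D (\<lambda>x. inner_d d (\<lambda>i. x i - \<mu> i) v) k"
proof -
  interpret prob_space D using D by (simp add: distribution_on_def)
  have int: "integrable D (\<lambda>x. x i)" "expectation (\<lambda>x. x i) = \<mu> i" if "i < d" for i
    using mean that by (auto simp: has_mean_def)
  show ?thesis
  proof
    show "(\<lambda>x. inner_d d (\<lambda>i. x i - \<mu> i) v) \<in> borel_measurable D"
      unfolding inner_d_def
      by (intro borel_measurable_sum borel_measurable_times borel_measurable_diff borel_measurable_const
          borel_measurable_integrable[OF int(1)]) auto
    show "(\<integral>\<^sup>+x. ennreal (\<bar>inner_d d (\<lambda>i. x i - \<mu> i) v\<bar> powr k) \<partial>D) \<le> 1"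
      using mom v by (simp add: moment_le_1_def)
    have "expectation (\<lambda>x. inner_d d (\<lambda>i. x i - \<mu> i) v) = (\<Sum>i<d. expectation (\<lambda>x. (x i - \<mu> i) * v i))"
      unfolding inner_d_def using int(1) by (intro Bochner_Integration.integral_sum) auto
    also have "\<dots> = 0" using int by (intro sum.neutral) (auto simp: prob_space)
    finally show "expectation (\<lambda>x. inner_d d (\<lambda>i. x i - \<mu> i) v) = 0" .
  qed (rule k)
qed

text \<open>Bad candidates within distance \<tau> have a gap linear in the distance
  \<open>r\<close>. Half of its exponent yields the fixed factor \<open>exp (- Q / 2)\<close>
  because \<open>r > \<alpha>\<close>, and the other half a decay summable over the grid. Beyond
  \<tau> the gap is constant and the grid points are counted. Each group contributes at most
  \<open>\<beta> / 4\<close>.\<close>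

lemma exponential_mechanism_failure_le:
  fixes d n :: nat and \<epsilon> \<alpha> \<beta> R \<tau> :: real and s :: "(nat \<Rightarrow> real) \<Rightarrow> real"
  assumes d: "d \<ge> 1" and \<epsilon>: "\<epsilon> > 0" and \<alpha>: "\<alpha> > 0" and \<tau>: "\<tau> > 0" and \<beta>: "0 < \<beta>" "\<beta> < 1" and R: "R \<ge> 0"
  defines "h \<equiv> \<alpha> / (20 * sqrt (real d))" and "l \<equiv> ln (max 2 (real d) / \<beta>)"
  defines "G \<equiv> grid d h \<lceil>R / h\<rceil>"
  assumes gap: "\<And>y. y \<in> G \<Longrightarrow> L2_set (\<lambda>i. y i - \<mu> i) {..<d} > \<alpha> \<Longrightarrow>
      s y - s0 \<ge> 7 / 20 * (real n * min (L2_set (\<lambda>i. y i - \<mu> i) {..<d}) \<tau>)"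
    and l2: "l \<ge> ln 2" and l4: "ln (4 / \<beta>) \<le> 3 * real d * l"
    and Q: "\<epsilon> * real n * \<alpha> / (12 * \<tau>) \<ge> 40 * real d * l"
    and far: "(2 * R / h + 3) ^ d * exp (- (\<epsilon> * real n / 12)) \<le> \<beta> / 4"
  shows "(\<Sum>y\<in>{y \<in> G. L2_set (\<lambda>i. y i - \<mu> i) {..<d} > \<alpha>}. exp (- (\<epsilon> / (4 * \<tau>)) * s y))
    \<le> \<beta> / 2 * exp (- (\<epsilon> / (4 * \<tau>)) * s0)"
proof -
  define Q where "Q = \<epsilon> * real n * \<alpha> / (12 * \<tau>)"
  define a where "a = Q / (2 * \<alpha>)"
  let ?r = "\<lambda>y. L2_set (\<lambda>i. y i - \<mu> i) {..<d}"
  let ?B = "{y \<in> G. ?r y > \<alpha>}"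
  have finG: "finite G" by (simp add: G_def finite_grid)
  have sd: "sqrt (real d) > 0" using d by simp
  have h0: "h > 0" using \<alpha> sd by (simp add: h_def)
  have ln2: "ln 2 \<ge> (2 / 3 :: real)" by (rule ln2_ge_two_thirds)
  have dl: "real d * l \<ge> l" using mult_right_mono[of 1 "real d" l] d l2 ln2 by simp
  have Q40: "Q \<ge> 40 * real d * l" using Q by (simp add: Q_def)
  then have Q0: "Q > 0" using dl l2 ln2 by linarith
  have a0: "a \<ge> 0" using Q0 \<alpha> by (simp add: a_def)
  have ah: "a * h = Q / (40 * sqrt (real d))" using \<alpha> by (simp add: a_def h_def)
  have each: "exp (- (\<epsilon> / (4 * \<tau>)) * s y) \<le>
      exp (- (\<epsilon> / (4 * \<tau>)) * s0) * (exp (- (Q / 2)) * exp (- a * ?r y) + exp (- (\<epsilon> * real n / 12)))"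
    if y: "y \<in> ?B" for y
  proof -
    have r: "?r y > \<alpha>" using y by simp
    have "\<epsilon> / (4 * \<tau>) * (s y - s0) \<ge> \<epsilon> / (4 * \<tau>) * (7 / 20 * (real n * min (?r y) \<tau>))"
      using gap y \<epsilon> \<tau> by (intro mult_left_mono) auto
    also have "\<epsilon> / (4 * \<tau>) * (7 / 20 * (real n * min (?r y) \<tau>)) = 7 / 80 * (\<epsilon> * real n * min (?r y) \<tau> / \<tau>)"
      by simp
    \<comment> \<open>7/80 = (7/20) / 4 is rounded down to 1/12, which is the origin of the 12 in
      \<open>Q\<close> and in the bound for distant candidates.\<close>
    also have "\<dots> \<ge> 1 / 12 * (\<epsilon> * real n * min (?r y) \<tau> / \<tau>)"
      using r \<alpha> \<epsilon> \<tau> by (intro mult_right_mono) (auto simp: min_def)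
    finally have g: "\<epsilon> / (4 * \<tau>) * (s y - s0) \<ge> 1 / 12 * (\<epsilon> * real n * min (?r y) \<tau> / \<tau>)" .
    have "exp (- (1 / 12 * (\<epsilon> * real n * min (?r y) \<tau> / \<tau>))) \<le> exp (- (Q / 2)) * exp (- a * ?r y) + exp (- (\<epsilon> * real n / 12))"
    proof (cases "?r y \<le> \<tau>")
      case True
      have "a * \<alpha> \<le> a * ?r y" using r a0 by (intro mult_left_mono) auto
      then have "Q / 2 \<le> a * ?r y" using \<alpha> by (simp add: a_def)
      moreover have "1 / 12 * (\<epsilon> * real n * min (?r y) \<tau> / \<tau>) = 2 * (a * ?r y)"
        using True \<alpha> \<tau> by (simp add: a_def Q_def)
      ultimately have "- (1 / 12 * (\<epsilon> * real n * min (?r y) \<tau> / \<tau>)) \<le> - (Q / 2) + (- a * ?r y)" by linarith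
      then have "exp (- (1 / 12 * (\<epsilon> * real n * min (?r y) \<tau> / \<tau>))) \<le> exp (- (Q / 2) + (- a * ?r y))"
        by (simp only: exp_le_cancel_iff)
      also have "\<dots> = exp (- (Q / 2)) * exp (- a * ?r y)" by (rule exp_add)
      finally show ?thesis by (rule order_trans) simp
    next
      case False
      then show ?thesis using \<tau> by simp
    qed
    moreover have "exp (- (\<epsilon> / (4 * \<tau>)) * s y) = exp (- (\<epsilon> / (4 * \<tau>)) * s0) * exp (- (\<epsilon> / (4 * \<tau>) * (s y - s0)))"
      by (simp flip: exp_add add: right_diff_distrib)
    moreover have "exp (- (\<epsilon> / (4 * \<tau>) * (s y - s0))) \<le> exp (- (1 / 12 * (\<epsilon> * real n * min (?r y) \<tau> / \<tau>)))"
      using g by (simp only: exp_le_cancel_iff neg_le_iff_le)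
    ultimately show ?thesis by (simp only:) (intro mult_left_mono; (linarith | simp))
  qed
  have near: "(\<Sum>y\<in>G. exp (- (Q / 2)) * exp (- a * ?r y)) \<le> \<beta> / 4"
  proof -
    \<comment> \<open>The decay over one grid step must be at least 1/2 for the geometric series. As
      the step is \<open>h = \<alpha> / (20 sqrt d)\<close>, this is where
      \<open>Q \<ge> 40 d l\<close> is needed.\<close>
    have b: "a * h / sqrt (real d) \<ge> ln 2"
    proof -
      have "a * h / sqrt (real d) = Q / (40 * real d)" unfolding ah by simp
      also have "\<dots> \<ge> l" using Q40 d by (simp add: field_simps)
      finally show ?thesis using l2 by linarith
    qed
    have ahd: "a * h * sqrt (real d) = Q / 40" unfolding ah using sd by simp
    have "(\<Sum>y\<in>G. exp (- (Q / 2)) * exp (- a * ?r y)) \<le> exp (- (Q / 2)) * (3 ^ d * exp (a * h * sqrt (real d)))"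
      unfolding sum_distrib_left[symmetric] G_def
      by (intro mult_left_mono sum_grid_exp_le d h0 a0 b) auto
    also have "\<dots> = exp (real d * ln 3 + Q / 40 - Q / 2)"
    proof -
      have "exp (- u) * (3 ^ d * exp v) = exp (real d * ln 3 + v - u)" for u v
        by (simp add: exp_add exp_of_nat_mult diff_conv_add_uminus del: add_uminus_conv_diff)
      then show ?thesis unfolding ahd .
    qed
    also have "\<dots> \<le> exp (- ln (4 / \<beta>))"
    proof -
      have "ln 3 \<le> 2 * ln (2::real)" using ln_realpow[of 2 2] ln_mono[of 3 4] by simp
      then have "real d * ln 3 \<le> real d * (2 * l)" using l2 by (intro mult_left_mono) auto
      then have "real d * ln 3 \<le> 2 * (real d * l)" by simp
      moreover have "real d * l \<ge> 0" using dl l2 ln2 by linarith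
      ultimately have "real d * ln 3 + Q / 40 - Q / 2 \<le> - ln (4 / \<beta>)" using Q40 l4 by linarith
      then show ?thesis by simp
    qed
    also have "\<dots> = \<beta> / 4" using \<beta> by (simp add: exp_minus)
    finally show ?thesis .
  qed
  have far': "(\<Sum>y\<in>G. exp (- (\<epsilon> * real n / 12))) \<le> \<beta> / 4"
  proof -
    have "(\<Sum>y\<in>G. exp (- (\<epsilon> * real n / 12))) \<le> (2 * R / h + 3) ^ d * exp (- (\<epsilon> * real n / 12))"
      unfolding G_def using card_grid_le[OF refl R h0, of d] by (simp add: mult_right_mono)
    then show ?thesis using far by linarith
  qed
  have "(\<Sum>y\<in>?B. exp (- (\<epsilon> / (4 * \<tau>)) * s y)) \<le> (\<Sum>y\<in>?B. exp (- (\<epsilon> / (4 * \<tau>)) * s0) *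
      (exp (- (Q / 2)) * exp (- a * ?r y) + exp (- (\<epsilon> * real n / 12))))"
    by (rule sum_mono[OF each])
  also have "\<dots> \<le> (\<Sum>y\<in>G. exp (- (\<epsilon> / (4 * \<tau>)) * s0) *
      (exp (- (Q / 2)) * exp (- a * ?r y) + exp (- (\<epsilon> * real n / 12))))"
    using finG by (intro sum_mono2) (auto intro!: mult_nonneg_nonneg add_nonneg_nonneg)
  also have "\<dots> = exp (- (\<epsilon> / (4 * \<tau>)) * s0) *
      ((\<Sum>y\<in>G. exp (- (Q / 2)) * exp (- a * ?r y)) + (\<Sum>y\<in>G. exp (- (\<epsilon> * real n / 12))))"
    unfolding sum.distrib[symmetric] by (rule sum_distrib_left[symmetric])
  also have "\<dots> \<le> exp (- (\<epsilon> / (4 * \<tau>)) * s0) * (\<beta> / 4 + \<beta> / 4)"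
    by (intro mult_left_mono add_mono near far') auto
  finally show ?thesis by (simp add: mult.commute)
qed

lemma exists_accurate_private_mechanism:
  fixes d m n :: nat and k \<epsilon> \<alpha> \<beta> R :: real
  assumes k: "k \<ge> 2" and d: "d \<ge> 1" and m: "m \<ge> 1" and \<epsilon>: "\<epsilon> > 0" and \<alpha>: "0 < \<alpha>" "\<alpha> \<le> 1"
    and t: "real m * \<alpha> powr (k / (k - 1)) \<le> 1 / 100" and \<beta>: "0 < \<beta>" "\<beta> < 1"
    and R: "\<alpha> < R * sqrt (real d)"
    and n: "real n \<ge> 200000 * tail_const k * sample_bound k d m R \<epsilon> \<alpha> \<beta>"
  shows "\<exists>A. mechanism n m d A \<and> person_level_dp n m d \<epsilon> A \<and>
        (\<forall>D \<mu>. distribution_on d D \<longrightarrow> has_mean d D \<mu> \<longrightarrow>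
           (\<forall>i<d. \<mu> i \<in> {-R..R}) \<longrightarrow> moment_le_1 d k D \<mu> \<longrightarrow>
           measure (output_distr n m D A)
             {y \<in> space (euclid d). L2_set (\<lambda>i. y i - \<mu> i) {..<d} \<le> \<alpha>} \<ge> 1 - \<beta>)"
proof -
  define \<tau> where "\<tau> = clip_level k m \<alpha>"
  \<comment> \<open>Rounding each coordinate then moves the mean by at most
    \<open>h sqrt d = \<alpha> / 20\<close>, as \<open>score_gap\<close> demands.\<close>
  define h where "h = \<alpha> / (20 * sqrt (real d))"
  define G where "G = grid d h \<lceil>R / h\<rceil>"
  note \<tau>b = clip_level_bounds[OF k m \<alpha> t, folded \<tau>_def]
  note size = sample_size_consequences[OF k d m \<epsilon> \<alpha> t \<beta> R n, folded \<tau>_def h_def]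
  have \<tau>0: "\<tau> > 0" by (rule \<tau>b)
  have sd: "sqrt (real d) > 0" using d by simp
  have h0: "h > 0" using \<alpha> sd by (simp add: h_def)
  have R0: "R > 0" using R \<alpha> sd by (smt (verit) mult_nonpos_nonneg)
  have hd: "h * sqrt (real d) = \<alpha> / 20" using sd by (simp add: h_def)
  obtain N where N: "finite N" "N \<noteq> {}" "\<And>v. v \<in> N \<Longrightarrow> L2_set v {..<d} = 1"
    "\<And>v. v \<in> N \<Longrightarrow> (\<lambda>i. - v i) \<in> N" "card N \<le> 2 * (9 * d) ^ d"
    "\<And>u. \<exists>v\<in>N. inner_d d u v \<ge> L2_set u {..<d} / 2"
    using exists_unit_net[OF d] by blast
  have finG: "finite G" and subG: "G \<subseteq> space (euclid d)" by (simp_all add: G_def finite_grid grid_subset)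
  have neG: "G \<noteq> {}"
    using exists_grid_point_near[OF refl h0, of d "\<lambda>_. 0" R] R0 by (auto simp: G_def)
  \<comment> \<open>Low scores are good. Since a person changes the score by at most
    \<open>2 \<tau>\<close>, each weight changes by a factor of at most
    \<open>exp (\<epsilon> / 2)\<close>.\<close>
  define w where "w y X = exp (- (\<epsilon> / (4 * \<tau>)) * score N d m n \<tau> y X)" for y X
  have pos: "w y X > 0" for y X by (simp add: w_def)
  define A where "A = finite_mechanism (euclid d) G w"
  have "w y \<in> borel_measurable (datasets n m d)" for y
    unfolding w_def[abs_def] using score_measurable[OF N(1,2), of d m n \<tau> y] by measurable
  then have A: "A \<in> datasets n m d \<rightarrow>\<^sub>M prob_algebra (euclid d)"
    unfolding A_def by (intro measurable_finite_mechanism finG neG subG pos) auto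
  have ratio: "w y X \<le> exp (\<epsilon> / 2) * w y X'" if "person_neighbours n X X'" for y X X'
  proof -
    have "\<epsilon> / (4 * \<tau>) * score N d m n \<tau> y X' \<le> \<epsilon> / (4 * \<tau>) * (score N d m n \<tau> y X + 2 * \<tau>)"
      using score_neighbours[OF N(1,2) \<tau>0 person_neighbours_sym[OF that]] \<epsilon> \<tau>0
      by (intro mult_left_mono) auto
    also have "\<dots> = \<epsilon> / (4 * \<tau>) * score N d m n \<tau> y X + \<epsilon> / 2"
      using \<tau>0 by (simp add: field_simps)
    finally have "- (\<epsilon> / (4 * \<tau>)) * score N d m n \<tau> y X \<le> \<epsilon> / 2 + - (\<epsilon> / (4 * \<tau>)) * score N d m n \<tau> y X'"
      by linarith
    then have "w y X \<le> exp (\<epsilon> / 2 + - (\<epsilon> / (4 * \<tau>)) * score N d m n \<tau> y X')"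
      unfolding w_def by (simp only: exp_le_cancel_iff)
    then show ?thesis unfolding w_def exp_add .
  qed
  have dp: "person_level_dp n m d \<epsilon> A"
    unfolding person_level_dp_def A_def
    by (intro ballI impI measure_finite_mechanism_ratio finG neG subG pos ratio)
       (auto intro: person_neighbours_sym)
  have acc: "measure (output_distr n m D A) {y \<in> space (euclid d). L2_set (\<lambda>i. y i - \<mu> i) {..<d} \<le> \<alpha>} \<ge> 1 - \<beta>"
    if D: "distribution_on d D" and mean: "has_mean d D \<mu>" and \<mu>: "\<forall>i<d. \<mu> i \<in> {-R..R}"
      and mom: "moment_le_1 d k D \<mu>" for D \<mu>
  proof -
    note P = iid_batches_props[OF D, of n m]
    let ?P = "iid_batches n m D"
    let ?G = "{y \<in> space (euclid d). L2_set (\<lambda>i. y i - \<mu> i) {..<d} \<le> \<alpha>}"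
    interpret P: prob_space ?P by (rule P)
    have A': "A \<in> ?P \<rightarrow>\<^sub>M prob_algebra (euclid d)"
      using A measurable_cong_sets[OF P(2) refl] by blast
    define p where "p X v i = proj d m v (X i) - inner_d d \<mu> v" for X :: "nat \<Rightarrow> nat \<Rightarrow> nat \<Rightarrow> real" and v i
    \<comment> \<open>The bad events are centred at the true mean and mention no candidate, so the
      union bound runs over the net only.\<close>
    define E where "E v = {X \<in> space ?P. (\<Sum>i<n. skew_clip \<tau> (p X v i)) < - (real n * \<alpha> / 20)}" for v
    have Ev: "E v \<in> sets ?P" "measure ?P (E v) \<le> exp (- (real n * real m * \<alpha>\<^sup>2 / 5000))" if v: "v \<in> N" for v
    proof -
      interpret cm: centred_moment D "\<lambda>x. inner_d d (\<lambda>i. x i - \<mu> i) v" k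
        by (rule centred_moment_projection[OF D mean mom k N(3)[OF v]])
      have avg: "p X v i = cm.avg m (X i)" for X i
      proof -
        have "inner_d d (\<lambda>l. X i j l - \<mu> l) v = inner_d d (X i j) v - inner_d d \<mu> v" for j
          by (simp add: inner_d_def left_diff_distrib sum_subtractf)
        then show ?thesis
          using m by (simp add: p_def cm.avg_def proj_def sum_subtractf diff_divide_distrib)
      qed
      have [measurable]: "cm.avg m \<in> borel_measurable (\<Pi>\<^sub>M j\<in>{..<m}. D)" using cm.integrable_avg by auto
      show "E v \<in> sets ?P" unfolding E_def avg iid_batches_def by measurable
      show "measure ?P (E v) \<le> exp (- (real n * real m * \<alpha>\<^sup>2 / 5000))"
        unfolding E_def avg iid_batches_def \<tau>_def by (rule cm.clipped_mean_lower_tail[OF m \<alpha> t])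
    qed
    have E: "(\<Union>v\<in>N. E v) \<in> sets ?P" using Ev N(1) by auto
    have "measure ?P (\<Union>v\<in>N. E v) \<le> (\<Sum>v\<in>N. measure ?P (E v))"
      using Ev N(1) by (intro P.finite_measure_subadditive_finite) auto
    also have "\<dots> \<le> (\<Sum>v\<in>N. exp (- (real n * real m * \<alpha>\<^sup>2 / 5000)))" using Ev by (intro sum_mono) auto
    also have "\<dots> \<le> 2 * (9 * real d) ^ d * exp (- (real n * real m * \<alpha>\<^sup>2 / 5000))"
    proof -
      have "real (card N) \<le> real (2 * (9 * d) ^ d)" using N(5) by (rule of_nat_mono)
      then show ?thesis by (simp add: mult_right_mono)
    qed
    also have "\<dots> \<le> \<beta> / 2" by (rule size(3))
    finally have mE: "measure ?P (\<Union>v\<in>N. E v) \<le> \<beta> / 2" .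
    obtain y0 where y0: "y0 \<in> G" "L2_set (\<lambda>i. y0 i - \<mu> i) {..<d} \<le> \<alpha> / 20"
      using exists_grid_point_near[OF refl h0, of d \<mu> R] \<mu> unfolding G_def hd by blast
    have "measure (A X) (space (euclid d) - ?G) \<le> \<beta> / 2" if X: "X \<in> space ?P - (\<Union>v\<in>N. E v)" for X
    proof -
      have sc: "score N d m n \<tau> y X = (MAX v\<in>N. \<Sum>i<n. clip \<tau> (p X v i + inner_d d (\<lambda>i. \<mu> i - y i) v))" for y
        by (simp add: score_def p_def inner_d_def left_diff_distrib sum_subtractf)
      have comm: "L2_set (\<lambda>i. \<mu> i - y i) {..<d} = L2_set (\<lambda>i. y i - \<mu> i) {..<d}" for y
        by (simp add: L2_set_def power2_commute)
      have gap: "score N d m n \<tau> y X - score N d m n \<tau> y0 X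
          \<ge> 7 / 20 * (real n * min (L2_set (\<lambda>i. y i - \<mu> i) {..<d}) \<tau>)"
        if "L2_set (\<lambda>i. y i - \<mu> i) {..<d} > \<alpha>" for y
        unfolding sc comm[symmetric]
      proof (rule score_gap[OF N(1,2,3,4,6)])
        show "p X (\<lambda>l. - v l) i = - p X v i" for v i
          by (simp add: p_def proj_def inner_d_def sum_negf)
        show "(\<Sum>i<n. skew_clip \<tau> (p X v i)) \<ge> - (real n * \<alpha> / 20)" if "v \<in> N" for v
          using X that by (auto simp: E_def not_less)
      qed (use that y0 \<alpha> \<tau>b comm in auto)
      let ?B = "{y \<in> G. L2_set (\<lambda>i. y i - \<mu> i) {..<d} > \<alpha>}"
      have "(\<Sum>y\<in>?B. w y X) \<le> \<beta> / 2 * w y0 X"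
        unfolding w_def G_def h_def
        by (rule exponential_mechanism_failure_le[OF d \<epsilon> \<alpha>(1) \<tau>0 \<beta>])
           (use gap size R0 in \<open>auto simp: h_def\<close>)
      also have "\<dots> \<le> \<beta> / 2 * (\<Sum>y\<in>G. w y X)"
        using y0 finG pos \<beta> by (intro mult_left_mono member_le_sum) (auto intro: less_imp_le)
      finally have "(\<Sum>y\<in>?B. w y X) / (\<Sum>y\<in>G. w y X) \<le> \<beta> / 2"
        using weight_sum_pos[OF finG neG subG, of w X, OF pos] by (simp add: divide_le_eq)
      moreover have "G \<inter> (space (euclid d) - ?G) = ?B" using subG by (auto simp: not_le)
      moreover have "measure (A X) (space (euclid d) - ?G)
          = (\<Sum>y\<in>G \<inter> (space (euclid d) - ?G). w y X) / (\<Sum>y\<in>G. w y X)"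
        unfolding A_def
        by (intro measure_finite_mechanism finG neG subG pos sets.compl_sets accurate_set_measurable)
      ultimately show ?thesis by simp
    qed
    \<comment> \<open>One half of \<beta> is spent on atypical datasets, the other on the sampling
      of the candidate.\<close>
    then have "measure (?P \<bind> A) ?G \<ge> 1 - (\<beta> / 2 + \<beta> / 2)"
      by (intro measure_bind_ge[OF A' P(1) accurate_set_measurable E mE]) (use \<beta> in auto)
    then show ?thesis by (simp add: output_distr_def)
  qed
  show ?thesis using A dp acc by (intro exI[of _ A]) (auto simp: mechanism_def)
qed

theorem theorem5p9:
  shows "\<exists>c>0. \<forall>k::real. k \<ge> 2 \<longrightarrow> (\<exists>C>0.
    \<forall>(d::nat) (m::nat) (n::nat) (R::real) (\<epsilon>::real) (\<alpha>::real) (\<beta>::real).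
      d \<ge> 1 \<longrightarrow> m \<ge> 1 \<longrightarrow> \<epsilon> > 0 \<longrightarrow> \<alpha> > 0 \<longrightarrow> \<beta> > 0 \<longrightarrow>
      \<alpha> \<le> c * real m powr (- ((k - 1) / k)) \<longrightarrow>
      real n \<ge> C * sample_bound k d m R \<epsilon> \<alpha> \<beta> \<longrightarrow>
      (\<exists>A. mechanism n m d A \<and> person_level_dp n m d \<epsilon> A \<and>
        (\<forall>D \<mu>. distribution_on d D \<longrightarrow> has_mean d D \<mu> \<longrightarrow>
           (\<forall>i<d. \<mu> i \<in> {-R..R}) \<longrightarrow> moment_le_1 d k D \<mu> \<longrightarrow>
           measure (output_distr n m D A)
             {y \<in> space (euclid d). L2_set (\<lambda>i. y i - \<mu> i) {..<d} \<le> \<alpha>} \<ge> 1 - \<beta>)))"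
proof (rule exI[of _ "1 / 100"], intro conjI allI impI)
  fix k :: real assume k: "k \<ge> 2"
  show "\<exists>C>0. \<forall>(d::nat) (m::nat) (n::nat) (R::real) (\<epsilon>::real) (\<alpha>::real) (\<beta>::real).
      d \<ge> 1 \<longrightarrow> m \<ge> 1 \<longrightarrow> \<epsilon> > 0 \<longrightarrow> \<alpha> > 0 \<longrightarrow> \<beta> > 0 \<longrightarrow>
      \<alpha> \<le> 1 / 100 * real m powr (- ((k - 1) / k)) \<longrightarrow>
      real n \<ge> C * sample_bound k d m R \<epsilon> \<alpha> \<beta> \<longrightarrow>
      (\<exists>A. mechanism n m d A \<and> person_level_dp n m d \<epsilon> A \<and>
        (\<forall>D \<mu>. distribution_on d D \<longrightarrow> has_mean d D \<mu> \<longrightarrow>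
           (\<forall>i<d. \<mu> i \<in> {-R..R}) \<longrightarrow> moment_le_1 d k D \<mu> \<longrightarrow>
           measure (output_distr n m D A)
             {y \<in> space (euclid d). L2_set (\<lambda>i. y i - \<mu> i) {..<d} \<le> \<alpha>} \<ge> 1 - \<beta>))"
  proof (rule exI[of _ "200000 * tail_const k"], intro conjI allI impI)
    show "200000 * tail_const k > 0" using tail_const_ge[of k] k by simp
    fix d m n :: nat and R \<epsilon> \<alpha> \<beta> :: real
    assume d: "d \<ge> 1" and m: "m \<ge> 1" and \<epsilon>: "\<epsilon> > 0" and \<alpha>: "\<alpha> > 0" and \<beta>: "\<beta> > 0"
      and small: "\<alpha> \<le> 1 / 100 * real m powr (- ((k - 1) / k))"
      and n: "real n \<ge> 200000 * tail_const k * sample_bound k d m R \<epsilon> \<alpha> \<beta>"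
    \<comment> \<open>The conjugate exponent of \<open>k\<close>: raising the assumption on \<alpha>
      to the power \<open>q\<close> turns it into
      \<open>m \<alpha>^q \<le> (1/100)^q \<le> 1/100\<close>, with a constant independent of
      \<open>k\<close>.\<close>
    define q where "q = k / (k - 1)"
    have q: "q \<ge> 1" "(k - 1) / k * q = 1" using k by (auto simp: q_def field_simps)
    have "real m powr (- ((k - 1) / k)) \<le> real m powr 0" using m k by (intro powr_mono) auto
    then have \<alpha>1: "\<alpha> \<le> 1" using small m by simp
    have "\<alpha> powr q \<le> (1 / 100 * real m powr (- ((k - 1) / k))) powr q"
      using small \<alpha> q by (intro powr_mono2) auto
    also have "\<dots> = (1 / 100) powr q * real m powr (- 1)"
      using q(2) by (subst powr_mult) (auto simp: powr_powr)
    also have "\<dots> \<le> 1 / 100 * real m powr (- 1)"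
      using powr_mono'[of 1 q "1 / 100"] q by (intro mult_right_mono) auto
    finally have "\<alpha> powr q \<le> 1 / 100 / real m" using m by (simp add: powr_minus_divide)
    then have t: "real m * \<alpha> powr (k / (k - 1)) \<le> 1 / 100" using m by (simp add: q_def field_simps)
    show "\<exists>A. mechanism n m d A \<and> person_level_dp n m d \<epsilon> A \<and>
        (\<forall>D \<mu>. distribution_on d D \<longrightarrow> has_mean d D \<mu> \<longrightarrow>
           (\<forall>i<d. \<mu> i \<in> {-R..R}) \<longrightarrow> moment_le_1 d k D \<mu> \<longrightarrow>
           measure (output_distr n m D A)
             {y \<in> space (euclid d). L2_set (\<lambda>i. y i - \<mu> i) {..<d} \<le> \<alpha>} \<ge> 1 - \<beta>)"
    proof (cases "\<beta> \<ge> 1 \<or> R * sqrt (real d) \<le> \<alpha>")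
      case True
      then show ?thesis by (rule constant_mechanism[OF \<epsilon> \<beta>])
    next
      case False
      then show ?thesis using exists_accurate_private_mechanism[OF k d m \<epsilon> \<alpha> \<alpha>1 t \<beta> _ _ n] by auto
    qed
  qed
qed simp

end
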